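(* For every integer $N\ge0$ and every integer $j\ge0$, $$\mathsf C^{\mathrm{fwd}}_{1,N}(j)=\begin{cases}1, & j=N+1,\\ (q^2-1)q^{N-j-1}, & 1\le j\le N-1,\ j\equiv N+1\pmod2,\\ (q-1)q^{N-1}, & j=0,\ N\text{ odd},\\ 0, & \text{otherwise}.\end{cases}$$
   Context: Let $q$ be a prime power, $F=\mathbb F_q((t^{-1}))$, $\mathcal O=\mathbb F_q[[t^{-1}]]$, $\pi=t^{-1}$. $\mathcal T$ is the Bruhat--Tits tree of $\mathrm{PGL}_2(F)$: vertices are homothety classes $[L]$ of $\mathcal O$-lattices in $F^2$, adjacent if representatives can be chosen with $\pi L\subsetneq L'\subsetneq L$, $L/L'\simeq\mathbb F_q$; it is $(q+1)$-regular. Put $v_n=[\mathrm{diag}(t^n,1)]\cdot[\mathcal O^2]$. The quotient of $\mathcal T$ by $\mathrm{PGL}_2(\mathbb F_q[t])$ is a ray represented by $v_0-v_1-\cdots$, and the height $h(v)$ of a vertex is the $n\ge0$ for which $v$ lies in the orbit of $v_n$. All neighbors of a height-$0$ vertex have height $1$; a vertex of height $k\ge1$ has exactly one neighbor of height $k+1$ and exactly $q$ of height $k-1$. An oriented edge $e=(z_{-1},z_0)$ with $h(z_0)=k\ge1$ is in the forward state $(\mathrm{fwd},k)$ if $h(z_{-1})=k-1$. $\mathrm{Desc}_N(e)$ is the set of terminal vertices $z_N$ of non-backtracking paths $z_{-1}\to z_0\to\cdots\to z_N$ ($q^N$ elements). $\mathsf C^{\mathrm{fwd}}_{k,N}(j)$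 is the number of vertices of height $j$ in $\mathrm{Desc}_N(e)$ for $e$ in state $(\mathrm{fwd},k)$; it depends only on the state. *)

theory Defs
  imports
    "HOL-Analysis.Cartesian_Space"
    "HOL-Computational_Algebra.Formal_Laurent_Series"
    "HOL-Number_Theory.Cong"
begin

text \<open>
  The finite field with $q$ elements is a type \<open>'a :: {field, finite}\<close>, with $q$ = \<open>CARD('a)\<close>.
  The field $F$ of formal Laurent series in $t^{-1}$ is \<open>'a fls\<close>: its formal variable \<^const>\<open>fls_X\<close>
  plays the role of $t^{-1}$, so that $t$ is \<^const>\<open>fls_X_inv\<close>.  The ring
  $O$ of power series in $t^{-1}$ is \<open>'a fps\<close>, embedded in $F$ by \<^const>\<open>fps_to_fls\<close>;
  its residue map to the finite field is the constant coefficient.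
\<close>

type_synonym 'a vertex = "(('a fls ^ 2) set) set"

definition lattice :: "('a::{field,finite} fls ^ 2) set \<Rightarrow> bool" where
  "lattice L \<longleftrightarrow> (\<exists>u w. u \<noteq> w \<and> vec.independent {u, w} \<and>
     L = {fps_to_fls a *s u + fps_to_fls b *s w | a b. True})"

definition homothety_class :: "('a::{field,finite} fls ^ 2) set \<Rightarrow> 'a vertex" where
  "homothety_class L = {(*s) c ` L | c. c \<noteq> 0}"

definition coset :: "('a::{field,finite} fls ^ 2) set \<Rightarrow> 'a fls ^ 2 \<Rightarrow> ('a fls ^ 2) set" where
  "coset L' x = (+) x ` L'"

text \<open>The $O$-module $L/L'$ is isomorphic to the residue field.\<close>

definition quotient_iso_residue_field ::
    "('a::{field,finite} fls ^ 2) set \<Rightarrow> ('a fls ^ 2) set \<Rightarrow> bool" where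
  "quotient_iso_residue_field L L' \<longleftrightarrow> (\<exists>\<phi> :: ('a fls ^ 2) set \<Rightarrow> 'a.
     bij_betw \<phi> (coset L' ` L) UNIV \<and>
     (\<forall>x\<in>L. \<forall>y\<in>L. \<phi> (coset L' (x + y)) = \<phi> (coset L' x) + \<phi> (coset L' y)) \<and>
     (\<forall>a. \<forall>x\<in>L. \<phi> (coset L' (fps_to_fls a *s x)) = fps_nth a 0 * \<phi> (coset L' x)))"

definition adjacent :: "'a::{field,finite} vertex \<Rightarrow> 'a vertex \<Rightarrow> bool" where
  "adjacent x y \<longleftrightarrow> (\<exists>L L'. lattice L \<and> lattice L' \<and>
     x = homothety_class L \<and> y = homothety_class L' \<and>
     (*s) fls_X ` L \<subset> L' \<and> L' \<subset> L \<and> quotient_iso_residue_field L L')"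

definition act :: "'a::{field,finite} fls ^ 2 ^ 2 \<Rightarrow> 'a vertex \<Rightarrow> 'a vertex" where
  "act g x = (`) ((*v) g) ` x"

definition std_lattice :: "('a::{field,finite} fls ^ 2) set" where
  "std_lattice = {x. \<forall>i. vec_nth x i \<in> range fps_to_fls}"

definition std_vertex :: "nat \<Rightarrow> 'a::{field,finite} vertex" where
  "std_vertex n = act (vector [vector [fls_X_inv ^ n, 0], vector [0, 1]])
     (homothety_class std_lattice)"

text \<open>The embedding of the polynomial ring in $t$ into $F$.\<close>

definition poly_to_fls :: "'a::{field,finite} poly \<Rightarrow> 'a fls" where
  "poly_to_fls p = poly (map_poly fls_const p) fls_X_inv"

text \<open>
  Orbits are taken under $GL_2$ of the polynomial ring; these are the orbits of $PGL_2$,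
  since scalar matrices act trivially on homothety classes.
\<close>

definition orbit :: "'a::{field,finite} vertex \<Rightarrow> 'a vertex set" where
  "orbit x = {act (map_matrix poly_to_fls g) x | g :: 'a poly ^ 2 ^ 2. invertible g}"

definition height :: "'a::{field,finite} vertex \<Rightarrow> nat" where
  "height v = (THE n. v \<in> orbit (std_vertex n))"

definition fwd_state :: "'a::{field,finite} vertex \<times> 'a vertex \<Rightarrow> nat \<Rightarrow> bool" where
  "fwd_state e k \<longleftrightarrow> adjacent (fst e) (snd e) \<and> k \<ge> 1 \<and>
     height (snd e) = k \<and> height (fst e) = k - 1"

text \<open>The list \<open>zs\<close> is $z_{-1}, z_0, \dots, z_N$, so \<open>zs ! i\<close> is $z_{i-1}$.\<close>

definition nonbacktracking_path :: "'a::{field,finite} vertex list \<Rightarrow> bool" where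
  "nonbacktracking_path zs \<longleftrightarrow>
     (\<forall>i. Suc i < length zs \<longrightarrow> adjacent (zs ! i) (zs ! Suc i)) \<and>
     (\<forall>i. Suc (Suc i) < length zs \<longrightarrow> zs ! Suc (Suc i) \<noteq> zs ! i)"

definition Desc :: "nat \<Rightarrow> 'a::{field,finite} vertex \<times> 'a vertex \<Rightarrow> 'a vertex set" where
  "Desc N e = {last zs | zs. length zs = N + 2 \<and> nonbacktracking_path zs \<and>
     zs ! 0 = fst e \<and> zs ! 1 = snd e}"

definition desc_count :: "'a::{field,finite} vertex \<times> 'a vertex \<Rightarrow> nat \<Rightarrow> nat \<Rightarrow> nat" where
  "desc_count e N j = card {v \<in> Desc N e. height v = j}"

end

theory Submission
  imports Defs
begin

text \<open>
  The count rests on three facts about the graph of homothety classes of lattices: it is a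
  \<open>(q+1)\<close>-regular tree, every vertex has a well-defined height, and a vertex of height \<open>k\<close> has
  exactly one neighbour of height \<open>k + 1\<close>, all its other neighbours having height \<open>k - 1\<close>
  (height \<open>1\<close> if \<open>k = 0\<close>).

  All three become visible in ball coordinates.  By column operations over the power series ring,
  every lattice is homothetic to one generated by \<open>(\<pi>\<^sup>m, 0)\<close> and \<open>(b, 1)\<close>
  (\<open>lattice_class_is_ball\<close>), and the class depends exactly on the ball \<open>b + \<pi>\<^sup>m O\<close> of Laurent series
  (\<open>ball_vertex_eq_iff\<close>).  The neighbours of a ball are the ball of the next larger radius that
  contains it and the \<open>q\<close> balls of the next smaller radius inside it (\<open>adjacent_ball_iff\<close>).  So
  \<open>m\<close> is a level, every vertex has a unique parent one level lower, and every edge joins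
  a vertex to its parent.

  This parent structure makes the graph acyclic: a non-backtracking path climbs to parents for a
  while and then only descends, since after a descending step a climb would undo it.  How long
  it climbs is read off from its length and the levels of its ends, so the path is determined by
  its length and its ends (\<open>walk_determined_by_ends\<close>).  Counting descendants is therefore the same
  as counting non-backtracking paths.

  For heights, the vertex \<open>v\<^sub>n\<close> is the ball \<open>\<pi>\<^sup>-\<^sup>n O\<close> around \<open>0\<close>.  Its children are translates of
  \<open>v\<^sub>n\<^sub>-\<^sub>1\<close> by polynomials when \<open>n \<ge> 1\<close>, and translates of a mirror image of \<open>v\<^sub>1\<close> when
  \<open>n = 0\<close>.  Hence the orbits of \<open>v\<^sub>0, v\<^sub>1, \<dots>\<close> are closed under adjacency and, because large balls
  contain \<open>0\<close>, exhaust all vertices.  They are distinct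
  (\<open>std_vertex_orbit_inj\<close>) because a matrix taking \<open>v\<^sub>n\<close> to \<open>v\<^sub>m\<close> and its inverse have entries of bounded degree,
  and unless \<open>m = n\<close> this forces a row or a column of one of them to vanish.

  The count itself follows the last edge of a path.  An edge going up at height \<open>k\<close> continues in
  one way upwards and in \<open>q - 1\<close> ways downwards; an edge going down continues downwards in \<open>q\<close> ways
  until it reaches height \<open>0\<close>, where all \<open>q\<close> continuations go up.  Starting with an upward edge
  ending at height \<open>1\<close>, induction on \<open>N\<close> gives the number of paths whose last edge goes up or
  down into height \<open>j\<close> (\<open>counts_closed_form\<close>).  For \<open>1 \<le> j \<le> N - 1\<close> of the right parity
  these are \<open>(q - 1) q\<^sup>N\<^sup>-\<^sup>j\<close> and \<open>(q - 1) q\<^sup>N\<^sup>-\<^sup>j\<^sup>-\<^sup>1\<close>, with sum \<open>(q\<^sup>2 - 1) q\<^sup>N\<^sup>-\<^sup>j\<^sup>-\<^sup>1\<close>.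
\<close>

(* The infix dollar sign denotes components of vectors; shared with coefficients of power series,
   it makes the parsing of longer formulas ambiguous. *)
no_notation fps_nth (infixl "$" 75)

section \<open>Non-backtracking paths in a tree over a ray\<close>

text \<open>
  The combinatorial content of the quotient ray, separated from lattices: heights of neighbours
  are distributed as over a ray with \<open>q\<close> edges down for one edge up, and acyclicity is encoded by orienting every edge
  towards a fixed end of the tree.  The parent of a vertex is its neighbour in the direction of that
  end, and the level drops by one at each step towards it.
\<close>

locale ray_quotient_tree =
  fixes adj :: "'v \<Rightarrow> 'v \<Rightarrow> bool" and h :: "'v \<Rightarrow> nat" and q :: nat
    and parent :: "'v \<Rightarrow> 'v" and level :: "'v \<Rightarrow> int"
  assumes adj_sym: "adj x y \<Longrightarrow> adj y x"
    and card_neighbours: "adj x y \<Longrightarrow> card {z. adj x z} = q + 1"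
    and heights: "adj x y \<Longrightarrow> \<exists>z. adj x z \<and> h z = Suc (h x) \<and>
      (\<forall>w. adj x w \<longrightarrow> w \<noteq> z \<longrightarrow> h w = (if h x = 0 then 1 else h x - 1))"
    and adj_parent: "adj x y \<Longrightarrow> y = parent x \<or> x = parent y"
    and level_parent: "adj x y \<Longrightarrow> level (parent x) = level x - 1"
begin

text \<open>
  A walk is a function on all of \<open>nat\<close> of which only the values up to \<open>n\<close> matter; this spares
  the bookkeeping with lists in the arguments on levels.
\<close>

definition walk :: "(nat \<Rightarrow> 'v) \<Rightarrow> nat \<Rightarrow> bool" where
  "walk f n \<longleftrightarrow> (\<forall>i<n. adj (f i) (f (Suc i))) \<and> (\<forall>i. Suc (Suc i) \<le> n \<longrightarrow> f (Suc (Suc i)) \<noteq> f i)"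

lemma walk_Suc_imp: "walk f (Suc n) \<Longrightarrow> walk f n"
  by (auto simp: walk_def)

text \<open>
  A step away from the parent is never followed by a step to the parent, which would go back to
  where the walk came from.  So a walk whose last step is to the parent has made only such steps.
\<close>

lemma walk_ending_upwards:
  assumes "walk f (Suc n)" "f (Suc n) = parent (f n)"
  shows "i \<le> Suc n \<Longrightarrow> f i = (parent ^^ i) (f 0)" "level (f (Suc n)) = level (f 0) - int (Suc n)"
proof -
  have "(\<forall>i\<le>Suc n. f i = (parent ^^ i) (f 0)) \<and> level (f (Suc n)) = level (f 0) - int (Suc n)"
    using assms
  proof (induction n)
    case 0
    then have "adj (f 0) (f 1)" "f 1 = parent (f 0)"
      by (simp_all add: walk_def)
    then show ?case
      using level_parent[of "f 0" "f 1"] by (simp add: le_Suc_eq all_conj_distrib)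
  next
    case (Suc n)
    have "adj (f n) (f (Suc n))" "adj (f (Suc n)) (f (Suc (Suc n)))" "f (Suc (Suc n)) \<noteq> f n"
      using Suc.prems(1) by (auto simp: walk_def)
    with adj_parent[of "f n" "f (Suc n)"] Suc.prems(2) have "f (Suc n) = parent (f n)"
      by auto
    note IH0 = Suc.IH[OF walk_Suc_imp[OF Suc.prems(1)] this]
    have IH: "f i = (parent ^^ i) (f 0)" if "i \<le> Suc n" for i
      by (rule IH0[THEN conjunct1, rule_format, OF that])
    note level = IH0[THEN conjunct2]
    have "f (Suc (Suc n)) = (parent ^^ Suc (Suc n)) (f 0)"
      unfolding Suc.prems(2) funpow.simps(2)[of "Suc n"] o_apply IH[OF order_refl] ..
    then have all: "f i = (parent ^^ i) (f 0)" if "i \<le> Suc (Suc n)" for i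
      using IH[of i] that by (cases "i = Suc (Suc n)") auto
    have "level (f (Suc (Suc n))) = level (f (Suc n)) - 1"
      using level_parent \<open>adj (f (Suc n)) _\<close> Suc.prems(2) by simp
    with level have "level (f (Suc (Suc n))) = level (f 0) - int (Suc (Suc n))"
      by simp
    with all show ?case by blast
  qed
  then show "i \<le> Suc n \<Longrightarrow> f i = (parent ^^ i) (f 0)" "level (f (Suc n)) = level (f 0) - int (Suc n)"
    by blast+
qed

lemma level_walk_ge: "walk f n \<Longrightarrow> level (f n) \<ge> level (f 0) - int n"
proof (induction n)
  case (Suc n)
  have "adj (f n) (f (Suc n))"
    using Suc.prems by (simp add: walk_def)
  then have "level (f (Suc n)) \<ge> level (f n) - 1"
    using adj_parent[of "f n" "f (Suc n)"] level_parent adj_sym by fastforce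
  with Suc.IH walk_Suc_imp[OF Suc.prems] show ?case by simp
qed simp

text \<open>
  Acyclicity.  If both walks end with a step to the parent, both consist of iterated parents of the
  common start.  If both end with a step from a parent, their last but one vertices are the parent
  of the common end, and induction applies.  The mixed case is excluded by levels: the walk of
  the first kind loses \<open>n\<close> levels, a walk of the second kind loses fewer.
\<close>

lemma walk_determined_by_ends:
  assumes "walk f n" "walk g n" "f 0 = g 0" "f n = g n" "i \<le> n"
  shows "f i = g i"
  using assms
proof (induction n arbitrary: i)
  case (Suc n)
  have adj: "adj (f n) (f (Suc n))" "adj (g n) (g (Suc n))"
    using Suc.prems by (auto simp: walk_def)
  have no_mix: False
    if "walk f (Suc n)" "walk g (Suc n)" "f 0 = g 0" "f (Suc n) = g (Suc n)"
      "f (Suc n) = parent (f n)" "g n = parent (g (Suc n))" for f g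
  proof -
    have "level (f (Suc n)) = level (f 0) - int (Suc n)"
      using walk_ending_upwards(2) that by blast
    moreover have "level (g n) \<ge> level (g 0) - int n"
      using level_walk_ge walk_Suc_imp that(2) by blast
    moreover have "level (g n) = level (g (Suc n)) - 1"
      using that(2,6) level_parent adj_sym by (metis lessI walk_def)
    ultimately show False
      using that by simp
  qed
  show ?case
  proof (cases "f (Suc n) = parent (f n)")
    case True
    then have "g (Suc n) = parent (g n)"
      using no_mix[of f g] Suc.prems adj_parent[OF adj(2)] by blast
    then show ?thesis
      using walk_ending_upwards(1) True Suc.prems by metis
  next
    case False
    then have fn: "f n = parent (f (Suc n))"
      using adj_parent[OF adj(1)] by blast
    then have "g n = parent (g (Suc n))"
      using no_mix[of g f] Suc.prems adj_parent[OF adj(2)] by metis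
    then have "f n = g n"
      using fn Suc.prems by simp
    then show ?thesis
      using Suc walk_Suc_imp by (metis le_Suc_eq)
  qed
qed simp

definition paths :: "'v \<Rightarrow> 'v \<Rightarrow> nat \<Rightarrow> 'v list set" where
  "paths x y N = {zs. length zs = N + 2 \<and> walk ((!) zs) (N + 1) \<and> zs ! 0 = x \<and> zs ! 1 = y}"

text \<open>
  This turns the count of end vertices into a count of paths.
\<close>

lemma inj_on_last_paths: "inj_on last (paths x y N)"
proof (rule inj_onI)
  fix zs zs' assume zs: "zs \<in> paths x y N" "zs' \<in> paths x y N" "last zs = last zs'"
  then have "zs \<noteq> []" "zs' \<noteq> []"
    by (auto simp: paths_def)
  with zs have "zs ! (N + 1) = zs' ! (N + 1)"
    by (simp add: paths_def last_conv_nth)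
  then have "zs ! i = zs' ! i" if "i \<le> N + 1" for i
    using zs that by - (rule walk_determined_by_ends[of "(!) zs" "N + 1" "(!) zs'"], auto simp: paths_def)
  then show "zs = zs'"
    using zs by (intro nth_equalityI) (auto simp: paths_def)
qed

text \<open>
  The admissible continuations of a path whose last edge leads from \<open>x\<close> to \<open>y\<close>.
\<close>

definition extensions :: "'v \<Rightarrow> 'v \<Rightarrow> 'v set" where
  "extensions x y = {z. adj y z \<and> z \<noteq> x}"

lemma finite_extensions: "adj x y \<Longrightarrow> finite (extensions x y)"
  using card_neighbours[OF adj_sym, of x y] card.infinite[of "{z. adj y z}"]
  unfolding extensions_def by (metis (no_types, lifting) Suc_eq_plus1 Zero_not_Suc finite_subset mem_Collect_eq subsetI)

lemma paths_0: "adj x y \<Longrightarrow> paths x y 0 = {[x, y]}"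
  by (auto simp: paths_def walk_def length_Suc_conv numeral_2_eq_2)

lemma walk_Suc_iff: "walk f (Suc (Suc n)) \<longleftrightarrow>
    walk f (Suc n) \<and> f (Suc (Suc n)) \<in> extensions (f n) (f (Suc n))"
proof -
  have "(\<forall>i. Suc (Suc i) \<le> Suc (Suc n) \<longrightarrow> P i) \<longleftrightarrow> (\<forall>i. Suc (Suc i) \<le> Suc n \<longrightarrow> P i) \<and> P n" for P
    by (auto simp: le_Suc_eq)
  then show ?thesis
    unfolding walk_def extensions_def All_less_Suc[of "Suc n"] by auto
qed

lemma walk_cong:
  assumes "\<And>i. i \<le> n \<Longrightarrow> f i = g i"
  shows "walk f n \<longleftrightarrow> walk g n"
proof -
  have "f i = g i \<and> f (Suc i) = g (Suc i)" if "i < n" for i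
    using assms that by simp
  moreover have "f i = g i \<and> f (Suc (Suc i)) = g (Suc (Suc i))" if "Suc (Suc i) \<le> n" for i
    using assms that by simp
  ultimately show ?thesis
    unfolding walk_def by metis
qed

lemma walk_append:
  assumes "length zs = N + 2"
  shows "walk ((!) (zs @ [z])) (Suc N + 1) \<longleftrightarrow>
    walk ((!) zs) (N + 1) \<and> z \<in> extensions (zs ! N) (zs ! Suc N)"
proof -
  have "walk ((!) (zs @ [z])) (Suc N) \<longleftrightarrow> walk ((!) zs) (Suc N)"
    using assms by (intro walk_cong) (simp add: nth_append)
  then show ?thesis
    using assms walk_Suc_iff[of "(!) (zs @ [z])" N] by (simp add: nth_append)
qed

lemma paths_Suc: "paths x y (Suc N) =
    (\<lambda>(zs, z). zs @ [z]) ` (SIGMA zs : paths x y N. extensions (zs ! N) (zs ! Suc N))"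
proof (intro equalityI subsetI)
  fix ws assume ws: "ws \<in> paths x y (Suc N)"
  then obtain zs z where zs: "ws = zs @ [z]" "length zs = N + 2"
    by (cases ws rule: rev_cases) (auto simp: paths_def)
  with ws have "zs \<in> paths x y N" "z \<in> extensions (zs ! N) (zs ! Suc N)"
    using walk_append[OF zs(2), of z] by (auto simp: paths_def nth_append)
  then show "ws \<in> (\<lambda>(zs, z). zs @ [z]) ` (SIGMA zs : paths x y N. extensions (zs ! N) (zs ! Suc N))"
    using zs(1) by force
next
  fix ws assume "ws \<in> (\<lambda>(zs, z). zs @ [z]) ` (SIGMA zs : paths x y N. extensions (zs ! N) (zs ! Suc N))"
  then obtain zs z where zs: "ws = zs @ [z]" "zs \<in> paths x y N" "z \<in> extensions (zs ! N) (zs ! Suc N)"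
    by auto
  then show "ws \<in> paths x y (Suc N)"
    using walk_append[of zs N z] by (auto simp: paths_def nth_append)
qed

lemma adj_last_edge: "zs \<in> paths x y N \<Longrightarrow> adj (zs ! N) (zs ! Suc N)"
  by (auto simp: paths_def walk_def)

lemma finite_paths: "adj x y \<Longrightarrow> finite (paths x y N)"
  by (induction N) (auto simp: paths_0 paths_Suc intro!: finite_extensions adj_last_edge)

text \<open>
  The recursion for counting paths by a property \<open>R\<close> of their last edge; only the last edge of the
  shorter path decides how it can be continued.
\<close>

lemma card_paths_Suc:
  assumes "adj x y"
  shows "card {ws \<in> paths x y (Suc N). R (ws ! Suc N) (ws ! Suc (Suc N))} =
    (\<Sum>zs\<in>paths x y N. card {z \<in> extensions (zs ! N) (zs ! Suc N). R (zs ! Suc N) z})"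
proof -
  let ?S = "SIGMA zs : paths x y N. {z \<in> extensions (zs ! N) (zs ! Suc N). R (zs ! Suc N) z}"
  have len: "length zs = Suc (Suc N)" if "zs \<in> paths x y N" for zs
    using that by (simp add: paths_def)
  have "{ws \<in> paths x y (Suc N). R (ws ! Suc N) (ws ! Suc (Suc N))} = (\<lambda>(zs, z). zs @ [z]) ` ?S"
    by (auto simp: paths_Suc nth_append len)
  moreover have "inj_on (\<lambda>(zs, z). zs @ [z]) ?S"
    by (auto simp: inj_on_def)
  ultimately show ?thesis
    using assms by (simp add: card_image finite_paths finite_extensions adj_last_edge)
qed

lemma adj_height:
  assumes "adj x y"
  shows "h y = Suc (h x) \<or> h x = Suc (h y)"
proof -
  obtain z where "adj x z" "h z = Suc (h x)"
      "\<And>w. adj x w \<Longrightarrow> w \<noteq> z \<Longrightarrow> h w = (if h x = 0 then 1 else h x - 1)"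
    using heights[OF assms] by blast
  then show ?thesis using assms by (cases "y = z") (auto split: if_splits)
qed

text \<open>
  If the last edge went up, the unique upper neighbour of its end is still available.  If it went
  down to positive height, that neighbour is where it came from.  At height \<open>0\<close> all
  neighbours are upper ones, and one of the \<open>q + 1\<close> is excluded.
\<close>

lemma card_extensions_up:
  assumes "adj x y"
  shows "card {z \<in> extensions x y. h z = Suc (h y)} =
    (if h y = Suc (h x) then 1 else if h y = 0 then q else 0)"
    (is "card ?U = _")
proof -
  obtain u where u: "adj y u" "h u = Suc (h y)"
      "\<And>w. adj y w \<Longrightarrow> w \<noteq> u \<Longrightarrow> h w = (if h y = 0 then 1 else h y - 1)"
    using heights[OF adj_sym[OF assms]] by blast
  have x: "adj y x" using assms by (rule adj_sym)
  consider "h y = Suc (h x)" | "h y = 0" "h x = 1" | "h y \<noteq> 0" "h x = Suc (h y)"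
    using adj_height[OF assms] by fastforce
  then show ?thesis
  proof cases
    case 1
    have "?U = {u}"
    proof -
      have "w = u" if "adj y w" "h w = Suc (h y)" for w
        using u(3)[OF that(1)] that(2) 1 by (cases "w = u") auto
      moreover have "u \<noteq> x"
        using u(2) 1 by auto
      ultimately show ?thesis
        unfolding extensions_def using u(1,2) by blast
    qed
    with 1 show ?thesis by simp
  next
    case 2
    then have "h w = 1" if "adj y w" for w
      using u(2,3) that by (cases "w = u") auto
    then have "?U = {z. adj y z} - {x}"
      using 2 by (auto simp: extensions_def)
    with 2 x show ?thesis
      using card_neighbours[OF x] by (simp add: card_Diff_singleton)
  next
    case 3
    have "x = u"
      using u(3)[OF x] 3 by (cases "x = u") auto
    then have "w = x" if "adj y w" "h w = Suc (h y)" for w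
      using u(3)[OF that(1)] that(2) 3 by (cases "w = u") auto
    then have none: "?U = {}"
      unfolding extensions_def by blast
    show ?thesis unfolding none using 3 by simp
  qed
qed

text \<open>
  Of the \<open>q + 1\<close> neighbours the upper one does not count, and the predecessor is a different one
  exactly if the last edge went up.
\<close>

lemma card_extensions_down:
  assumes "adj x y" "h y = Suc k"
  shows "card {z \<in> extensions x y. h z = k} = (if h y = Suc (h x) then q - 1 else q)"
    (is "card ?D = _")
proof -
  obtain u where u: "adj y u" "h u = Suc (h y)"
      "\<And>w. adj y w \<Longrightarrow> w \<noteq> u \<Longrightarrow> h w = k"
    using heights[OF adj_sym[OF assms(1)]] assms(2) by auto
  have x: "adj y x" using assms(1) by (rule adj_sym)
  show ?thesis
  proof (cases "h y = Suc (h x)")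
    case True
    have "x \<noteq> u" using True u by auto
    have "w \<noteq> u \<longleftrightarrow> h w = k" if "adj y w" for w
      using u(2,3) that assms(2) by (cases "w = u") auto
    then have "?D = {z. adj y z} - {u, x}"
      unfolding extensions_def by blast
    then show ?thesis
      using True card_neighbours[OF x] x u(1) \<open>x \<noteq> u\<close> by (simp add: card_Diff_subset)
  next
    case False
    have "x = u"
      using u(3)[OF x] False assms by (cases "x = u") auto
    then have "?D = {z. adj y z} - {x}"
      unfolding extensions_def using u(3) assms(2) u(2) by auto
    then show ?thesis
      using False card_neighbours[OF x] x by simp
  qed
qed

definition fwd_count :: "'v \<Rightarrow> 'v \<Rightarrow> nat \<Rightarrow> nat \<Rightarrow> nat" where
  "fwd_count x y N k = card {zs \<in> paths x y N. h (zs ! Suc N) = Suc (h (zs ! N)) \<and> h (zs ! Suc N) = k}"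

definition bwd_count :: "'v \<Rightarrow> 'v \<Rightarrow> nat \<Rightarrow> nat \<Rightarrow> nat" where
  "bwd_count x y N k = card {zs \<in> paths x y N. h (zs ! N) = Suc (h (zs ! Suc N)) \<and> h (zs ! Suc N) = k}"

lemma fwd_count_0 [simp]: "fwd_count x y N 0 = 0"
proof -
  have "{zs \<in> paths x y N. h (zs ! Suc N) = Suc (h (zs ! N)) \<and> h (zs ! Suc N) = 0} = {}"
    by auto
  then show ?thesis
    unfolding fwd_count_def by (simp only: card.empty)
qed

lemma sum_card_filter:
  "finite A \<Longrightarrow> (\<Sum>a\<in>A. if P a then c else 0) = c * card {a \<in> A. P a}"
  by (simp add: sum.If_cases Int_def mult.commute)

text \<open>
  An upward edge into height \<open>k + 1\<close> continues an upward edge into \<open>k\<close>, or a downward edge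
  into \<open>k = 0\<close>, where the path is reflected.
\<close>

lemma fwd_count_Suc:
  assumes "adj x y"
  shows "fwd_count x y (Suc N) (Suc k) = fwd_count x y N k + (if k = 0 then q * bwd_count x y N 0 else 0)"
proof -
  have "fwd_count x y (Suc N) (Suc k) = (\<Sum>zs\<in>paths x y N.
      card {z \<in> extensions (zs ! N) (zs ! Suc N). h z = Suc (h (zs ! Suc N)) \<and> h z = Suc k})"
    unfolding fwd_count_def by (rule card_paths_Suc[OF assms])
  also have "\<dots> = (\<Sum>zs\<in>paths x y N.
      (if h (zs ! Suc N) = Suc (h (zs ! N)) \<and> h (zs ! Suc N) = k then 1 else 0) +
      (if h (zs ! N) = Suc (h (zs ! Suc N)) \<and> h (zs ! Suc N) = k then if k = 0 then q else 0 else 0))"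
  proof (rule sum.cong[OF refl])
    fix zs assume "zs \<in> paths x y N"
    note adj = adj_last_edge[OF this]
    show "card {z \<in> extensions (zs ! N) (zs ! Suc N). h z = Suc (h (zs ! Suc N)) \<and> h z = Suc k} =
      (if h (zs ! Suc N) = Suc (h (zs ! N)) \<and> h (zs ! Suc N) = k then 1 else 0) +
      (if h (zs ! N) = Suc (h (zs ! Suc N)) \<and> h (zs ! Suc N) = k then if k = 0 then q else 0 else 0)"
    proof (cases "h (zs ! Suc N) = k")
      case True
      then have "{z \<in> extensions (zs ! N) (zs ! Suc N). h z = Suc (h (zs ! Suc N)) \<and> h z = Suc k} =
          {z \<in> extensions (zs ! N) (zs ! Suc N). h z = Suc (h (zs ! Suc N))}"
        by auto
      then show ?thesis
        using True card_extensions_up[OF adj] adj_height[OF adj] by auto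
    next
      case False
      then have none: "{z \<in> extensions (zs ! N) (zs ! Suc N). h z = Suc (h (zs ! Suc N)) \<and> h z = Suc k} = {}"
        by auto
      show ?thesis
        unfolding none using False by simp
    qed
  qed
  also have "\<dots> = fwd_count x y N k + (if k = 0 then q * bwd_count x y N 0 else 0)"
    unfolding sum.distrib sum_card_filter[OF finite_paths[OF assms]]
    by (simp add: fwd_count_def bwd_count_def)
  finally show ?thesis .
qed

lemma bwd_count_Suc:
  assumes "adj x y"
  shows "bwd_count x y (Suc N) k = (q - 1) * fwd_count x y N (Suc k) + q * bwd_count x y N (Suc k)"
proof -
  have "bwd_count x y (Suc N) k = (\<Sum>zs\<in>paths x y N.
      card {z \<in> extensions (zs ! N) (zs ! Suc N). h (zs ! Suc N) = Suc (h z) \<and> h z = k})"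
    unfolding bwd_count_def by (rule card_paths_Suc[OF assms])
  also have "\<dots> = (\<Sum>zs\<in>paths x y N.
      (if h (zs ! Suc N) = Suc (h (zs ! N)) \<and> h (zs ! Suc N) = Suc k then q - 1 else 0) +
      (if h (zs ! N) = Suc (h (zs ! Suc N)) \<and> h (zs ! Suc N) = Suc k then q else 0))"
  proof (rule sum.cong[OF refl])
    fix zs assume "zs \<in> paths x y N"
    note adj = adj_last_edge[OF this]
    show "card {z \<in> extensions (zs ! N) (zs ! Suc N). h (zs ! Suc N) = Suc (h z) \<and> h z = k} =
      (if h (zs ! Suc N) = Suc (h (zs ! N)) \<and> h (zs ! Suc N) = Suc k then q - 1 else 0) +
      (if h (zs ! N) = Suc (h (zs ! Suc N)) \<and> h (zs ! Suc N) = Suc k then q else 0)"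
    proof (cases "h (zs ! Suc N) = Suc k")
      case True
      then have "{z \<in> extensions (zs ! N) (zs ! Suc N). h (zs ! Suc N) = Suc (h z) \<and> h z = k} =
          {z \<in> extensions (zs ! N) (zs ! Suc N). h z = k}"
        by auto
      then show ?thesis
        using True card_extensions_down[OF adj True] adj_height[OF adj] by auto
    next
      case False
      then have none: "{z \<in> extensions (zs ! N) (zs ! Suc N). h (zs ! Suc N) = Suc (h z) \<and> h z = k} = {}"
        by auto
      show ?thesis
        unfolding none using False by simp
    qed
  qed
  also have "\<dots> = (q - 1) * fwd_count x y N (Suc k) + q * bwd_count x y N (Suc k)"
    unfolding sum.distrib sum_card_filter[OF finite_paths[OF assms]]
    by (simp add: fwd_count_def bwd_count_def)
  finally show ?thesis .
qed

text \<open>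
  In the induction step, reflection at height \<open>0\<close> turns \<open>(q - 1) q\<^sup>N\<^sup>-\<^sup>1\<close> downward edges into
  \<open>q \<cdot> (q - 1) q\<^sup>N\<^sup>-\<^sup>1\<close> upward ones, and the downward edges obey
  \<open>(q - 1) \<cdot> (q - 1) q\<^sup>d\<^sup>+\<^sup>1 + q \<cdot> (q - 1) q\<^sup>d = (q - 1) q\<^sup>d\<^sup>+\<^sup>2\<close> with \<open>d = N - k - 2\<close>.  The path that
  only goes up contributes the single upward edge into height \<open>N + 1\<close>; one step later it gives
  the \<open>q - 1\<close> downward edges into height \<open>N\<close>.
\<close>

lemma counts_closed_form:
  assumes "adj x y" "h x = 0" "h y = 1"
  shows "fwd_count x y N k = (if k = N + 1 then 1
      else if 1 \<le> k \<and> k + 1 \<le> N \<and> even (N + 1 + k) then (q - 1) * q ^ (N - k) else 0)"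
    and "bwd_count x y N k = (if k + 1 \<le> N \<and> even (N + 1 + k) then (q - 1) * q ^ (N - k - 1) else 0)"
proof (induction N arbitrary: k)
  case 0
  { case 1
    have "{zs \<in> paths x y 0. h (zs ! Suc 0) = Suc (h (zs ! 0)) \<and> h (zs ! Suc 0) = k} =
        (if k = 1 then {[x, y]} else {})"
      using assms by (auto simp: paths_0)
    then show ?case by (simp add: fwd_count_def)
  next
    case 2
    have none: "{zs \<in> paths x y 0. h (zs ! 0) = Suc (h (zs ! Suc 0)) \<and> h (zs ! Suc 0) = k} = {}"
      using assms by (auto simp: paths_0)
    show ?case unfolding bwd_count_def none by simp
  }
next
  case (Suc N)
  { case 1
    show ?case
    proof (cases k)
      case (Suc l)
      show ?thesis
        unfolding Suc fwd_count_Suc[OF assms(1)] Suc.IH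
        by (cases "l = 0") (auto simp: power_Suc[symmetric] simp del: power_Suc)
    qed simp
  next
    case 2
    show ?case
    proof (cases "k = N \<or> Suc k = N")
      case False
      have "(q - 1) * ((q - 1) * q ^ (N - Suc k)) + q * ((q - 1) * q ^ (N - Suc k - 1)) =
          (q - 1) * q ^ (N - k)" if "Suc k + 1 \<le> N"
      proof -
        define e where "e = N - Suc (Suc k)"
        have d: "N = Suc (Suc k) + e"
          using that by (simp add: e_def)
        show ?thesis
          unfolding d by (cases q) (auto simp: algebra_simps)
      qed
      then show ?thesis
        unfolding bwd_count_Suc[OF assms(1)] Suc.IH using False by auto
    qed (auto simp: bwd_count_Suc[OF assms(1)] Suc.IH)
  }
qed

end

section \<open>Orders of Laurent series\<close>

definition pi_pow :: "int \<Rightarrow> 'a::field fls" where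
  "pi_pow m = fls_X_intpow m"

lemma pi_pow_add: "pi_pow (m + n) = pi_pow m * pi_pow n"
  by (simp add: pi_pow_def fls_X_intpow_times_fls_X_intpow)

lemma pi_pow_0 [simp]: "pi_pow 0 = 1"
  by (simp add: pi_pow_def)

lemma pi_pow_1: "pi_pow 1 = fls_X"
  by (simp add: pi_pow_def fls_X_conv_shift_1)

lemma pi_pow_nonzero [simp]: "pi_pow m \<noteq> 0"
  by (simp add: pi_pow_def)

lemma subdegree_pi_pow [simp]: "fls_subdegree (pi_pow m :: 'a::field fls) = m"
  unfolding pi_pow_def by (rule fls_subdegree_fls_X_intpow)

text \<open>
  \<open>ord_ge m x\<close> says that \<open>x\<close> lies in \<open>\<pi>\<^sup>m O\<close>, where \<open>\<pi> = t\<^sup>-\<^sup>1\<close>; the case \<open>x = 0\<close> is separate because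
  the subdegree of \<open>0\<close> is \<open>0\<close> by convention.
\<close>

definition ord_ge :: "int \<Rightarrow> 'a::field fls \<Rightarrow> bool" where
  "ord_ge m x \<longleftrightarrow> x = 0 \<or> m \<le> fls_subdegree x"

lemma ord_ge_iff_nth: "ord_ge m x \<longleftrightarrow> (\<forall>k<m. fls_nth x k = 0)"
proof (cases "x = 0")
  case False
  then have "m \<le> fls_subdegree x" if "\<forall>k<m. fls_nth x k = 0"
    using that by (intro fls_subdegree_geI) auto
  then show ?thesis
    using False by (auto simp: ord_ge_def)
qed (simp add: ord_ge_def)

lemma ord_ge_0 [simp]: "ord_ge m 0"
  by (simp add: ord_ge_def)

lemma ord_ge_add: "ord_ge m x \<Longrightarrow> ord_ge m y \<Longrightarrow> ord_ge m (x + y)"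
  by (simp add: ord_ge_iff_nth)

lemma ord_ge_diff: "ord_ge m x \<Longrightarrow> ord_ge m y \<Longrightarrow> ord_ge m (x - y)"
  by (simp add: ord_ge_iff_nth)

lemma ord_ge_uminus [simp]: "ord_ge m (- x) \<longleftrightarrow> ord_ge m x"
  by (simp add: ord_ge_iff_nth)

lemma ord_ge_mult: "ord_ge m x \<Longrightarrow> ord_ge n y \<Longrightarrow> ord_ge (m + n) (x * y)"
  by (cases "x = 0 \<or> y = 0") (auto simp: ord_ge_def)

lemma ord_ge_mono: "ord_ge m x \<Longrightarrow> n \<le> m \<Longrightarrow> ord_ge n x"
  by (auto simp: ord_ge_def)

lemma ord_ge_pi_pow [simp]: "ord_ge n (pi_pow m) \<longleftrightarrow> n \<le> m"
  by (simp add: ord_ge_def)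

lemma ord_ge_pi_pow_mult [simp]: "ord_ge n (pi_pow m * x) \<longleftrightarrow> ord_ge (n - m) x"
  by (cases "x = 0") (auto simp: ord_ge_def)

lemma ord_ge_const [simp]: "ord_ge 0 (fls_const a)"
  by (simp add: ord_ge_iff_nth)

lemma ord_ge_0_iff: "ord_ge 0 x \<longleftrightarrow> x \<in> range fps_to_fls"
proof
  assume "ord_ge 0 x"
  then have "x = fps_to_fls (fls_regpart x)"
    by (auto simp: ord_ge_def)
  then show "x \<in> range fps_to_fls"
    by blast
qed (auto simp: ord_ge_def fls_subdegree_fls_to_fps_gt0)

lemma ord_ge_inverse_mult:
  assumes "c \<noteq> 0"
  shows "ord_ge m (inverse c * x) \<longleftrightarrow> ord_ge (m + fls_subdegree c) x"
  using assms by (cases "x = 0") (auto simp: ord_ge_def)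

lemma pi_pow_mult_inverse: "pi_pow m * pi_pow (- m) = (1 :: 'a::field fls)"
  by (simp flip: pi_pow_add)

section \<open>Lattices, homothety and equivariance of adjacency\<close>

lemma vec2_eq_iff: "(v :: 'b ^ 2) = w \<longleftrightarrow> v $ 1 = w $ 1 \<and> v $ 2 = w $ 2"
  by (simp add: vec_eq_iff forall_2)

lemma matrix2_eq_iff: "(A :: 'b ^ 2 ^ 2) = B \<longleftrightarrow>
    A $ 1 $ 1 = B $ 1 $ 1 \<and> A $ 1 $ 2 = B $ 1 $ 2 \<and> A $ 2 $ 1 = B $ 2 $ 1 \<and> A $ 2 $ 2 = B $ 2 $ 2"
  by (auto simp: vec2_eq_iff)

lemma matrix_vector_mult_2:
  "((A :: 'b::semiring_1 ^ 2 ^ 2) *v x) $ i = A $ i $ 1 * x $ 1 + A $ i $ 2 * x $ 2"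
  by (simp add: matrix_vector_mult_def sum_2)

lemma matrix_matrix_mult_2:
  "((A :: 'b::semiring_1 ^ 2 ^ 2) ** B) $ i $ j = A $ i $ 1 * B $ 1 $ j + A $ i $ 2 * B $ 2 $ j"
  by (simp add: matrix_matrix_mult_def sum_2)

lemma homothety_class_eq_iff:
  "homothety_class L = homothety_class L' \<longleftrightarrow> (\<exists>c. c \<noteq> 0 \<and> L' = (*s) c ` L)"
proof
  assume eq: "homothety_class L = homothety_class L'"
  have "(*s) 1 = (\<lambda>x :: 'a fls ^ 2. x)"
    by (rule ext) simp
  then have "L' \<in> homothety_class L'"
    unfolding homothety_class_def by (intro CollectI exI[of _ 1]) simp
  then have "L' \<in> homothety_class L"
    using eq by simp
  then show "\<exists>c. c \<noteq> 0 \<and> L' = (*s) c ` L"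
    unfolding homothety_class_def by blast
next
  assume "\<exists>c. c \<noteq> 0 \<and> L' = (*s) c ` L"
  then obtain c where c: "c \<noteq> 0" "L' = (*s) c ` L" by blast
  have 1: "(*s) d ` L' = (*s) (d * c) ` L" for d
    unfolding c(2) image_image by simp
  have 2: "(*s) d ` L = (*s) (d / c) ` L'" for d
    unfolding c(2) image_image using c(1) by simp
  show "homothety_class L = homothety_class L'"
    unfolding homothety_class_def
  proof (intro equalityI subsetI; clarify)
    fix d :: "'a fls" assume "d \<noteq> 0"
    then show "\<exists>e. (*s) d ` L = (*s) e ` L' \<and> e \<noteq> 0"
      using 2[of d] c(1) by (intro exI[of _ "d / c"]) simp
  next
    fix d :: "'a fls" assume "d \<noteq> 0"
    then show "\<exists>e. (*s) d ` L' = (*s) e ` L \<and> e \<noteq> 0"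
      using 1[of d] c(1) by (intro exI[of _ "d * c"]) simp
  qed
qed

lemma homothety_class_scale: "c \<noteq> 0 \<Longrightarrow> homothety_class ((*s) c ` L) = homothety_class L"
  by (subst eq_commute) (auto simp: homothety_class_eq_iff)

lemma act_homothety_class: "act g (homothety_class L) = homothety_class ((*v) g ` L)"
proof -
  have "(*v) g ` (*s) c ` L = (*s) c ` (*v) g ` L" for c
    by (simp add: image_image vector_scalar_commute)
  moreover have "act g (homothety_class L) = {(*v) g ` (*s) c ` L | c. c \<noteq> 0}"
    unfolding act_def homothety_class_def by blast
  ultimately show ?thesis
    unfolding homothety_class_def by simp
qed

lemma act_mult: "act (g ** h) x = act g (act h x)"
  unfolding act_def by (simp add: image_image matrix_vector_mul_assoc)

lemma act_mat_1 [simp]: "act (mat 1) x = x"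
  unfolding act_def by simp

text \<open>
  A basis \<open>u, w\<close> of a lattice gives the columns of the matrix; independence of the two columns is
  invertibility.  In this form lattices are visibly permuted by the linear group.
\<close>

lemma lattice_iff_image_std:
  "lattice L \<longleftrightarrow> (\<exists>g :: 'a::{field,finite} fls ^ 2 ^ 2. invertible g \<and> L = (*v) g ` std_lattice)"
proof -
  have inv_iff: "invertible g \<longleftrightarrow> column 1 g \<noteq> column 2 g \<and> vec.independent {column 1 g, column 2 g}"
    for g :: "'a fls ^ 2 ^ 2"
  proof -
    have "invertible g \<longleftrightarrow> (\<forall>c. sum (\<lambda>i. c i *s column i g) UNIV = 0 \<longrightarrow> (\<forall>i. c i = 0))"
      unfolding matrix_left_invertible_independent_columns[symmetric] by (rule invertible_left_inverse)
    also have "\<dots> \<longleftrightarrow> (\<forall>a b. a *s column 1 g + b *s column 2 g = 0 \<longrightarrow> a = 0 \<and> b = 0)"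
    proof (intro iffI allI impI)
      fix a b assume "\<forall>c. sum (\<lambda>i. c i *s column i g) UNIV = 0 \<longrightarrow> (\<forall>i. c i = 0)"
        and "a *s column 1 g + b *s column 2 g = 0"
      from this(1)[rule_format, of "\<lambda>i. if i = 1 then a else b"] this(2)
      have "\<forall>i::2. (if i = 1 then a else b) = 0" by (simp add: sum_2)
      then show "a = 0 \<and> b = 0" by (simp add: forall_2)
    next
      fix c and i :: 2 assume "\<forall>a b. a *s column 1 g + b *s column 2 g = 0 \<longrightarrow> a = 0 \<and> b = 0"
        and "sum (\<lambda>i. c i *s column i g) UNIV = 0"
      then have "\<forall>i. c i = 0" by (simp add: sum_2 forall_2)
      then show "c i = 0" ..
    qed
    also have "\<dots> \<longleftrightarrow> column 1 g \<noteq> column 2 g \<and> vec.independent {column 1 g, column 2 g}"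
    proof (intro iffI conjI allI impI)
      assume H: "\<forall>a b. a *s column 1 g + b *s column 2 g = 0 \<longrightarrow> a = 0 \<and> b = 0"
      show "column 1 g \<noteq> column 2 g"
        using H[rule_format, of 1 "-1"] by auto
      then show "vec.independent {column 1 g, column 2 g}"
        using H by (subst vec.dependent_finite) auto
    next
      assume H: "column 1 g \<noteq> column 2 g \<and> vec.independent {column 1 g, column 2 g}"
      fix a b assume ab: "a *s column 1 g + b *s column 2 g = 0"
      define f where "f = (\<lambda>x. if x = column 1 g then a else b)"
      have "(\<Sum>x\<in>{column 1 g, column 2 g}. f x *s x) = 0"
        using ab H by (auto simp: f_def)
      then have "\<forall>x\<in>{column 1 g, column 2 g}. f x = 0"
        using H by (subst (asm) vec.dependent_finite) auto
      then show "a = 0" "b = 0"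
        using H by (auto simp: f_def)
    qed
    finally show ?thesis .
  qed
  have img: "(*v) g ` std_lattice = {fps_to_fls a *s column 1 g + fps_to_fls b *s column 2 g | a b. True}"
    for g :: "'a fls ^ 2 ^ 2"
  proof (intro equalityI subsetI)
    fix y assume "y \<in> (*v) g ` std_lattice"
    then obtain x a b where "y = g *v x" "x $ 1 = fps_to_fls a" "x $ 2 = fps_to_fls b"
      by (auto simp: std_lattice_def forall_2)
    then have "y = fps_to_fls a *s column 1 g + fps_to_fls b *s column 2 g"
      by (simp add: vec2_eq_iff matrix_vector_mult_2 column_def mult.commute)
    then show "y \<in> {fps_to_fls a *s column 1 g + fps_to_fls b *s column 2 g | a b. True}"
      by blast
  next
    fix y assume "y \<in> {fps_to_fls a *s column 1 g + fps_to_fls b *s column 2 g | a b. True}"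
    then obtain a b where "y = fps_to_fls a *s column 1 g + fps_to_fls b *s column 2 g" by blast
    then have "y = g *v vector [fps_to_fls a, fps_to_fls b]"
      by (simp add: vec2_eq_iff matrix_vector_mult_2 column_def mult.commute)
    moreover have "vector [fps_to_fls a, fps_to_fls b] \<in> std_lattice"
      by (simp add: std_lattice_def forall_2)
    ultimately show "y \<in> (*v) g ` std_lattice" by blast
  qed
  show ?thesis
  proof
    assume "lattice L"
    then obtain u w where uw: "u \<noteq> w" "vec.independent {u, w}"
      "L = {fps_to_fls a *s u + fps_to_fls b *s w | a b. True}"
      unfolding lattice_def by blast
    define g :: "'a fls ^ 2 ^ 2" where "g = (\<chi> i j. if j = 1 then u $ i else w $ i)"
    have "column 1 g = u" "column 2 g = w"
      by (simp_all add: g_def column_def vec_eq_iff)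
    then have "invertible g" "L = (*v) g ` std_lattice"
      using uw by (simp_all add: inv_iff img)
    then show "\<exists>g :: 'a fls ^ 2 ^ 2. invertible g \<and> L = (*v) g ` std_lattice"
      by blast
  next
    assume "\<exists>g :: 'a fls ^ 2 ^ 2. invertible g \<and> L = (*v) g ` std_lattice"
    then show "lattice L"
      unfolding lattice_def using inv_iff img by blast
  qed
qed

lemma lattice_image: "invertible g \<Longrightarrow> lattice L \<Longrightarrow> lattice ((*v) g ` L)"
  unfolding lattice_iff_image_std
  by (metis (no_types, lifting) image_comp image_cong invertible_mult matrix_vector_mul_assoc o_apply)

lemma inj_matrix_vector_mult:
  fixes g :: "'b::field ^ 'n ^ 'n"
  shows "invertible g \<Longrightarrow> inj ((*v) g)"
  by (metis invertible_left_inverse matrix_left_invertible_injective)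

text \<open>
  The isomorphism onto the residue field is transported along the bijection that \<open>g\<close> induces on
  cosets.
\<close>

lemma quotient_iso_image:
  assumes g: "invertible g" and q: "quotient_iso_residue_field L L'"
  shows "quotient_iso_residue_field ((*v) g ` L) ((*v) g ` L')"
proof -
  obtain \<phi> :: "('a fls ^ 2) set \<Rightarrow> 'a" where
    bij: "bij_betw \<phi> (coset L' ` L) UNIV" and
    add: "\<forall>x\<in>L. \<forall>y\<in>L. \<phi> (coset L' (x + y)) = \<phi> (coset L' x) + \<phi> (coset L' y)" and
    scale: "\<forall>a. \<forall>x\<in>L. \<phi> (coset L' (fps_to_fls a *s x)) = fps_nth a 0 * \<phi> (coset L' x)"
    using q unfolding quotient_iso_residue_field_def by blast
  have coset: "coset ((*v) g ` L') (g *v x) = (*v) g ` coset L' x" for x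
    by (auto simp: coset_def image_image matrix_vector_right_distrib)
  have inj: "inj ((`) ((*v) g))"
    using inj_matrix_vector_mult[OF g] by (rule inj_on_image[of _ UNIV, simplified])
  define \<psi> where "\<psi> = \<phi> \<circ> inv ((`) ((*v) g))"
  have \<psi>: "\<psi> ((*v) g ` C) = \<phi> C" for C
    by (simp add: \<psi>_def inj)
  have "bij_betw \<psi> (coset ((*v) g ` L') ` (*v) g ` L) UNIV"
  proof -
    have "coset ((*v) g ` L') ` (*v) g ` L = (`) ((*v) g) ` coset L' ` L"
      by (simp add: image_image coset)
    moreover have "bij_betw (inv ((`) ((*v) g))) ((`) ((*v) g) ` coset L' ` L) (coset L' ` L)"
      using inj by (intro bij_betw_byWitness[where f' = "(`) ((*v) g)"]) auto
    ultimately show ?thesis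
      unfolding \<psi>_def using bij bij_betw_trans by metis
  qed
  moreover have "\<psi> (coset ((*v) g ` L') (g *v x + g *v y)) =
      \<psi> (coset ((*v) g ` L') (g *v x)) + \<psi> (coset ((*v) g ` L') (g *v y))"
    if "x \<in> L" "y \<in> L" for x y
    using add that unfolding matrix_vector_right_distrib[symmetric] coset \<psi> by blast
  moreover have "\<psi> (coset ((*v) g ` L') (fps_to_fls a *s (g *v x))) =
      fps_nth a 0 * \<psi> (coset ((*v) g ` L') (g *v x))" if "x \<in> L" for x a
    using scale that unfolding vector_scalar_commute[symmetric] coset \<psi> by blast
  ultimately show ?thesis
    unfolding quotient_iso_residue_field_def by (intro exI[of _ \<psi>]) blast
qed

text \<open>
  The relation between representatives that underlies adjacency of classes.
\<close>

definition index_q_sublattice :: "('a::{field,finite} fls ^ 2) set \<Rightarrow> ('a fls ^ 2) set \<Rightarrow> bool" where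
  "index_q_sublattice L L' \<longleftrightarrow> lattice L \<and> lattice L' \<and>
     (*s) fls_X ` L \<subset> L' \<and> L' \<subset> L \<and> quotient_iso_residue_field L L'"

lemma adjacent_iff_sublattice:
  "adjacent x y \<longleftrightarrow> (\<exists>L L'. x = homothety_class L \<and> y = homothety_class L' \<and> index_q_sublattice L L')"
  unfolding adjacent_def index_q_sublattice_def by blast

lemma index_q_sublattice_image:
  assumes "invertible g" "index_q_sublattice L L'"
  shows "index_q_sublattice ((*v) g ` L) ((*v) g ` L')"
proof -
  have "(*s) fls_X ` (*v) g ` L = (*v) g ` (*s) fls_X ` L"
    by (simp add: image_image vector_scalar_commute)
  then show ?thesis
    using assms inj_matrix_vector_mult[OF assms(1)]
    unfolding index_q_sublattice_def
    by (auto simp: lattice_image quotient_iso_image inj_image_subset_iff psubset_eq inj_image_eq_iff)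
qed

lemma adjacent_act_imp: "invertible g \<Longrightarrow> adjacent x y \<Longrightarrow> adjacent (act g x) (act g y)"
  unfolding adjacent_iff_sublattice by (metis act_homothety_class index_q_sublattice_image)

lemma adjacent_act_iff:
  assumes "invertible g"
  shows "adjacent (act g x) y \<longleftrightarrow> (\<exists>y'. y = act g y' \<and> adjacent x y')"
proof
  obtain h where h: "g ** h = mat 1" "h ** g = mat 1"
    using assms unfolding invertible_def by blast
  assume "adjacent (act g x) y"
  then have "adjacent (act h (act g x)) (act h y)"
    using h by (intro adjacent_act_imp) (auto simp: invertible_def)
  then show "\<exists>y'. y = act g y' \<and> adjacent x y'"
    using h by (intro exI[of _ "act h y"]) (simp flip: act_mult)
qed (use assms adjacent_act_imp in blast)

section \<open>Ball coordinates\<close>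

text \<open>
  The lattice generated by \<open>(\<pi>\<^sup>m, 0)\<close> and \<open>(b, 1)\<close>, described by conditions on coordinates.
\<close>

definition ball_lattice :: "int \<Rightarrow> 'a::{field,finite} fls \<Rightarrow> ('a fls ^ 2) set" where
  "ball_lattice m b = {v. ord_ge 0 (v $ 2) \<and> ord_ge m (v $ 1 - b * v $ 2)}"

definition ball_vertex :: "int \<Rightarrow> 'a::{field,finite} fls \<Rightarrow> 'a vertex" where
  "ball_vertex m b = homothety_class (ball_lattice m b)"

definition ball_matrix :: "int \<Rightarrow> 'a::{field,finite} fls \<Rightarrow> 'a fls ^ 2 ^ 2" where
  "ball_matrix m b = vector [vector [pi_pow m, b], vector [0, 1]]"

lemma invertible_ball_matrix: "invertible (ball_matrix m b)"
  unfolding invertible_def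
proof (intro exI conjI)
  let ?B = "vector [vector [pi_pow (- m), - (pi_pow (- m) * b)], vector [0, 1]] :: 'a fls ^ 2 ^ 2"
  have inv: "pi_pow m * (pi_pow (- m) * x) = x" "pi_pow (- m) * (pi_pow m * x) = x" for x :: "'a fls"
    unfolding mult.assoc[symmetric] pi_pow_add[symmetric] by simp_all
  show "ball_matrix m b ** ?B = mat 1" "?B ** ball_matrix m b = mat 1"
    using inv[of 1] by (auto simp: matrix2_eq_iff matrix_matrix_mult_2 ball_matrix_def mat_def inv)
qed

lemma image_ball_matrix:
  "(*v) (ball_matrix m b) ` ball_lattice n c = ball_lattice (m + n) (b + pi_pow m * c)"
proof (intro equalityI subsetI)
  fix w assume "w \<in> (*v) (ball_matrix m b) ` ball_lattice n c"
  then obtain v where v: "w = ball_matrix m b *v v" "v \<in> ball_lattice n c" by blast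
  have "w $ 1 - (b + pi_pow m * c) * w $ 2 = pi_pow m * (v $ 1 - c * v $ 2)"
    unfolding v(1) by (simp add: matrix_vector_mult_2 ball_matrix_def algebra_simps)
  moreover have "w $ 2 = v $ 2"
    unfolding v(1) by (simp add: matrix_vector_mult_2 ball_matrix_def)
  ultimately show "w \<in> ball_lattice (m + n) (b + pi_pow m * c)"
    using v(2) by (simp add: ball_lattice_def)
next
  fix w assume w: "w \<in> ball_lattice (m + n) (b + pi_pow m * c)"
  define v :: "'a fls ^ 2" where "v = vector [pi_pow (- m) * (w $ 1 - b * w $ 2), w $ 2]"
  have v1: "pi_pow m * v $ 1 = w $ 1 - b * w $ 2"
    unfolding v_def by (simp add: mult.assoc[symmetric] pi_pow_mult_inverse)
  then have "ball_matrix m b *v v = w"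
    by (simp add: vec2_eq_iff matrix_vector_mult_2 ball_matrix_def) (simp add: v_def)
  moreover have "pi_pow m * (v $ 1 - c * v $ 2) = w $ 1 - (b + pi_pow m * c) * w $ 2"
    unfolding right_diff_distrib v1 by (simp add: v_def algebra_simps)
  then have "ord_ge (m + n) (pi_pow m * (v $ 1 - c * v $ 2))"
    using w by (simp add: ball_lattice_def)
  then have "v \<in> ball_lattice n c"
    using w by (simp add: ball_lattice_def v_def)
  ultimately show "w \<in> (*v) (ball_matrix m b) ` ball_lattice n c"
    by blast
qed

lemma std_lattice_eq_ball: "std_lattice = ball_lattice 0 0"
  by (auto simp: std_lattice_def ball_lattice_def ord_ge_0_iff[symmetric] forall_2)

lemma lattice_ball: "lattice (ball_lattice m b)"
  unfolding lattice_iff_image_std std_lattice_eq_ball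
  using invertible_ball_matrix[of m b] image_ball_matrix[of m b 0 0] by auto

lemma act_ball_matrix: "act (ball_matrix m b) (ball_vertex n c) = ball_vertex (m + n) (b + pi_pow m * c)"
  by (simp add: ball_vertex_def act_homothety_class image_ball_matrix)

text \<open>
  The sign appears because \<open>t = \<pi>\<^sup>-\<^sup>1\<close>: the larger \<open>n\<close>, the larger the ball.
\<close>

lemma std_vertex_eq_ball: "std_vertex n = ball_vertex (- int n) 0"
proof -
  have "fls_X_inv ^ n = (pi_pow (- int n) :: 'a fls)"
    by (simp add: pi_pow_def fls_X_inv_power_conv_shift_1)
  then show ?thesis
    using act_ball_matrix[of "- int n" 0 0 0]
    by (simp add: std_vertex_def std_lattice_eq_ball ball_vertex_def ball_matrix_def)
qed

text \<open>
  Subtracting \<open>a\<close> times the second column from the first clears the lower left entry, and scaling by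
  the inverse of the lower right entry makes that entry \<open>1\<close>.  What is left is upper triangular with
  corner \<open>d\<close>, and only the order of \<open>d\<close> matters, units being absorbed by the lattice.
\<close>

lemma homothety_class_image_std:
  fixes g :: "'a::{field,finite} fls ^ 2 ^ 2"
  assumes inj: "\<And>x. g *v x = 0 \<Longrightarrow> x = 0" and nz: "g $ 2 $ 2 \<noteq> 0"
    and a: "g $ 2 $ 1 = a * g $ 2 $ 2" "ord_ge 0 a"
  shows "\<exists>m b. homothety_class ((*v) g ` std_lattice) = ball_vertex m b"
proof -
  define s where "s = g $ 2 $ 2"
  define d where "d = (g $ 1 $ 1 - a * g $ 1 $ 2) / s"
  define b where "b = g $ 1 $ 2 / s"
  define m where "m = fls_subdegree d"
  have s: "s \<noteq> 0" using nz by (simp add: s_def)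
  have g12: "g $ 1 $ 2 = s * b" and g11: "g $ 1 $ 1 = s * (d + a * b)"
    using s by (simp_all add: b_def d_def field_simps)
  \<comment> \<open>Otherwise the columns of \<open>g\<close> would be proportional.\<close>
  have "d \<noteq> 0"
  proof
    assume "d = 0"
    then have "g *v vector [1, - a] = 0"
      using a g11 g12 by (simp add: vec2_eq_iff matrix_vector_mult_2 algebra_simps)
    from inj[OF this] show False
      by (simp add: vec2_eq_iff)
  qed
  have "(*v) g ` std_lattice = (*s) s ` ball_lattice m b"
  proof (intro equalityI subsetI)
    fix w assume "w \<in> (*v) g ` std_lattice"
    then obtain x where x: "w = g *v x" "ord_ge 0 (x $ 1)" "ord_ge 0 (x $ 2)"
      by (auto simp: std_lattice_eq_ball ball_lattice_def)
    define v :: "'a fls ^ 2" where "v = vector [d * x $ 1 + b * (a * x $ 1 + x $ 2), a * x $ 1 + x $ 2]"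
    have "w = s *s v"
      using x(1) g11 g12 a(1) by (simp add: vec2_eq_iff matrix_vector_mult_2 v_def s_def algebra_simps)
    moreover have "ord_ge (m + 0) (d * x $ 1)"
      using x(2) by (intro ord_ge_mult) (auto simp: m_def ord_ge_def)
    then have "v \<in> ball_lattice m b"
      using x a(2) ord_ge_mult[of 0 a 0 "x $ 1"] by (simp add: ball_lattice_def v_def ord_ge_add)
    ultimately show "w \<in> (*s) s ` ball_lattice m b" by blast
  next
    fix w assume "w \<in> (*s) s ` ball_lattice m b"
    then obtain v where v: "w = s *s v" "v \<in> ball_lattice m b" by blast
    define \<alpha> where "\<alpha> = inverse d * (v $ 1 - b * v $ 2)"
    have \<alpha>: "ord_ge 0 \<alpha>"
      using v(2) \<open>d \<noteq> 0\<close> by (simp add: \<alpha>_def ord_ge_inverse_mult m_def ball_lattice_def)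
    have d\<alpha>: "d * \<alpha> = v $ 1 - b * v $ 2"
      using \<open>d \<noteq> 0\<close> by (simp add: \<alpha>_def)
    define x :: "'a fls ^ 2" where "x = vector [\<alpha>, v $ 2 - a * \<alpha>]"
    have "x \<in> std_lattice"
      using \<alpha> v(2) a(2) ord_ge_mult[of 0 a 0 \<alpha>]
      by (auto simp: x_def std_lattice_eq_ball ball_lattice_def intro: ord_ge_diff)
    moreover have "w = g *v x"
      unfolding v(1) vec2_eq_iff matrix_vector_mult_2
    proof
      have "g $ 1 $ 1 * x $ 1 + g $ 1 $ 2 * x $ 2 = s * (d * \<alpha> + b * v $ 2)"
        by (simp add: g11 g12 x_def algebra_simps)
      then show "(s *s v) $ 1 = g $ 1 $ 1 * x $ 1 + g $ 1 $ 2 * x $ 2"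
        by (simp add: d\<alpha>)
      show "(s *s v) $ 2 = g $ 2 $ 1 * x $ 1 + g $ 2 $ 2 * x $ 2"
        by (simp add: a(1) x_def s_def algebra_simps)
    qed
    ultimately show "w \<in> (*v) g ` std_lattice" by blast
  qed
  then show ?thesis
    using s by (auto simp: ball_vertex_def homothety_class_scale)
qed

text \<open>
  The Iwasawa decomposition.  One of the two entries in the bottom row divides the other in the
  valuation ring; if necessary the columns are exchanged.
\<close>

lemma lattice_class_is_ball:
  assumes "lattice L"
  shows "\<exists>m b. homothety_class L = ball_vertex m b"
proof -
  obtain g h :: "'a fls ^ 2 ^ 2" where L: "L = (*v) g ` std_lattice"
    and h: "g ** h = mat 1" "h ** g = mat 1"
    using assms unfolding lattice_iff_image_std invertible_def by blast
  have inj: "x = 0" if "g *v x = 0" for x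
    using h(2) that by (metis matrix_vector_mul_assoc matrix_vector_mul_lid matrix_vector_mult_0_right)
  define S :: "'a fls ^ 2 ^ 2" where "S = vector [vector [0, 1], vector [1, 0]]"
  have SS: "S *v (S *v x) = x" for x
    by (simp add: S_def vec2_eq_iff matrix_vector_mult_2)
  have S_std: "(*v) S ` std_lattice = std_lattice"
  proof -
    have "S *v x \<in> std_lattice" if "x \<in> std_lattice" for x
      using that by (simp add: S_def std_lattice_def forall_2 matrix_vector_mult_2)
    then show ?thesis using SS by (metis (no_types, lifting) image_eqI subsetI image_subset_iff subset_antisym)
  qed
  have row: "g $ 2 $ 1 \<noteq> 0 \<or> g $ 2 $ 2 \<noteq> 0"
  proof (rule ccontr)
    assume "\<not> ?thesis"
    then have "(g ** h) $ 2 $ 2 = 0" by (simp add: matrix_matrix_mult_2)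
    then show False unfolding h by (simp add: mat_def)
  qed
  show ?thesis
  proof (cases "g $ 2 $ 2 \<noteq> 0 \<and> ord_ge 0 (g $ 2 $ 1 / g $ 2 $ 2)")
    case True
    then show ?thesis
      unfolding L using inj by (intro homothety_class_image_std[of g "g $ 2 $ 1 / g $ 2 $ 2"]) auto
  next
    case False
    then have nz: "g $ 2 $ 1 \<noteq> 0"
      using row by auto
    have ord: "ord_ge 0 (inverse (g $ 2 $ 1) * g $ 2 $ 2)"
    proof (cases "g $ 2 $ 2 = 0")
      case nz2: False
      have "\<not> ord_ge 0 (inverse (g $ 2 $ 2) * g $ 2 $ 1)"
        using False nz2 by (simp add: field_simps)
      then show ?thesis
        using nz nz2 by (simp add: ord_ge_inverse_mult) (simp add: ord_ge_def)
    qed simp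
    define g' where "g' = g ** S"
    have g': "g' $ 2 $ 2 = g $ 2 $ 1" "g' $ 2 $ 1 = g $ 2 $ 2"
      by (simp_all add: g'_def S_def matrix_matrix_mult_2)
    have "x = 0" if "g' *v x = 0" for x
      using inj[of "S *v x"] that SS[of x] by (simp add: g'_def matrix_vector_mul_assoc[symmetric])
    then have "\<exists>m b. homothety_class ((*v) g' ` std_lattice) = ball_vertex m b"
      using nz ord by (intro homothety_class_image_std[of g' "inverse (g $ 2 $ 1) * g $ 2 $ 2"]) (auto simp: g')
    moreover have "(*v) g' ` std_lattice = (*v) g ` (*v) S ` std_lattice"
      by (simp add: g'_def image_image matrix_vector_mul_assoc)
    ultimately show ?thesis
      unfolding L S_std by simp
  qed
qed

lemma ball_lattice_cong:
  assumes "ord_ge m (b - c)"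
  shows "ball_lattice m b = ball_lattice m c"
proof -
  have "ball_lattice m b \<subseteq> ball_lattice m c" if "ord_ge m (b - c)" for b c :: "'a fls"
  proof
    fix v assume v: "v \<in> ball_lattice m b"
    have "ord_ge (m + 0) ((b - c) * v $ 2)"
      using that v by (intro ord_ge_mult) (auto simp: ball_lattice_def)
    then have "ord_ge m ((v $ 1 - b * v $ 2) + (b - c) * v $ 2)"
      using v by (intro ord_ge_add) (auto simp: ball_lattice_def)
    then show "v \<in> ball_lattice m c"
      using v by (simp add: ball_lattice_def algebra_simps)
  qed
  moreover have "ord_ge m (c - b)"
    using assms by (metis minus_diff_eq ord_ge_uminus)
  ultimately show ?thesis using assms by blast
qed

text \<open>
  Second coordinates of vectors in a ball lattice fill exactly the valuation ring, so the scalar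
  between two homothetic ball lattices is a unit.  Comparing the vectors with second coordinate
  \<open>0\<close> gives the radius, and comparing those with second coordinate \<open>1\<close> gives the centre.
\<close>

lemma ball_vertex_eq_iff: "ball_vertex m b = ball_vertex n c \<longleftrightarrow> m = n \<and> ord_ge m (b - c)"
proof
  assume "ball_vertex m b = ball_vertex n c"
  then obtain s where s: "s \<noteq> 0" "ball_lattice n c = (*s) s ` ball_lattice m b"
    unfolding ball_vertex_def homothety_class_eq_iff by blast
  have to: "s *s v \<in> ball_lattice n c" if "v \<in> ball_lattice m b" for v
    using that s(2) by blast
  have "vector [c, 1] \<in> ball_lattice n c"
    by (simp add: ball_lattice_def ord_ge_def)
  then obtain v where v: "vector [c, 1] = s *s v" "v \<in> ball_lattice m b"
    using s(2) by blast
  have v12: "c = s * v $ 1" "1 = s * v $ 2"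
    using v(1) by (auto simp: vec2_eq_iff)
  have "fls_subdegree (s * v $ 2) = 0"
    by (simp flip: v12(2))
  moreover have "v $ 2 \<noteq> 0"
    using v12(2) by auto
  ultimately have "fls_subdegree s + fls_subdegree (v $ 2) = 0"
    using s(1) by simp
  moreover have "0 \<le> fls_subdegree (v $ 2)"
    using v(2) by (auto simp: ball_lattice_def ord_ge_def)
  moreover have "ord_ge 0 s"
    using to[of "vector [b, 1]"] by (simp add: ball_lattice_def ord_ge_def)
  then have "0 \<le> fls_subdegree s"
    using s(1) by (simp add: ord_ge_def)
  ultimately have s0: "fls_subdegree s = 0" by simp
  have "n \<le> m"
    using to[of "vector [pi_pow m, 0]"] s0 s(1) by (simp add: ball_lattice_def) (simp add: ord_ge_def)
  moreover have "m \<le> n"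
  proof -
    have "vector [pi_pow n, 0] \<in> ball_lattice n c"
      by (simp add: ball_lattice_def)
    then obtain w where w: "vector [pi_pow n, 0] = s *s w" "w \<in> ball_lattice m b"
      using s(2) by blast
    have "pi_pow n = s * w $ 1" "w $ 2 = 0"
      using w(1) s(1) by (auto simp: vec2_eq_iff)
    moreover from this have "ord_ge (0 + m) (s * w $ 1)"
      using w(2) s0 by (intro ord_ge_mult) (auto simp: ball_lattice_def ord_ge_def)
    ultimately show ?thesis by (metis add_0 ord_ge_pi_pow)
  qed
  moreover have "ord_ge m (b - c)"
  proof -
    have "ord_ge (0 + m) (s * (v $ 1 - b * v $ 2))"
      using v(2) s0 by (intro ord_ge_mult) (auto simp: ball_lattice_def ord_ge_def)
    moreover have "s * (v $ 1 - b * v $ 2) = s * v $ 1 - b * (s * v $ 2)"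
      by (simp add: algebra_simps)
    ultimately have "ord_ge m (c - b)"
      using v12 by simp
    then show ?thesis by (metis minus_diff_eq ord_ge_uminus)
  qed
  ultimately show "m = n \<and> ord_ge m (b - c)" by simp
next
  assume "m = n \<and> ord_ge m (b - c)"
  then show "ball_vertex m b = ball_vertex n c"
    by (metis ball_lattice_cong ball_vertex_def)
qed

section \<open>Neighbours of the standard vertex\<close>

text \<open>
  The kernels of the nonzero linear forms on the reduction of the standard lattice modulo
  \<open>\<pi>\<close>; up to scalars the forms are the points of the projective line over the residue field, which
  is where the number \<open>q + 1\<close> of neighbours comes from.
\<close>

definition residue_kernel :: "'a \<Rightarrow> 'a \<Rightarrow> ('a::{field,finite} fls ^ 2) set" where
  "residue_kernel \<alpha> \<beta> = {v \<in> std_lattice. \<alpha> * fls_nth (v $ 1) 0 + \<beta> * fls_nth (v $ 2) 0 = 0}"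

lemma mem_std_lattice: "v \<in> std_lattice \<longleftrightarrow> ord_ge 0 (v $ 1) \<and> ord_ge 0 (v $ 2)"
  by (auto simp: std_lattice_eq_ball ball_lattice_def)

lemma ord_ge_1_iff: "ord_ge 1 x \<longleftrightarrow> ord_ge 0 x \<and> fls_nth x 0 = 0"
proof -
  have "k < 1 \<longleftrightarrow> k < 0 \<or> k = 0" for k :: int by auto
  then show ?thesis unfolding ord_ge_iff_nth by blast
qed

lemma residue_kernel_eq_ball:
  assumes "\<alpha> \<noteq> 0"
  shows "residue_kernel \<alpha> \<beta> = ball_lattice 1 (fls_const (- \<beta> / \<alpha>))"
proof (intro equalityI subsetI)
  fix v :: "'a fls ^ 2"
  let ?c = "- \<beta> / \<alpha>"
  have lin: "\<alpha> * x + \<beta> * y = 0 \<longleftrightarrow> x - ?c * y = 0" for x y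
    using assms by (simp add: field_simps)
  { assume v: "v \<in> residue_kernel \<alpha> \<beta>"
    have "ord_ge (0 + 0) (fls_const ?c * v $ 2)"
      using v by (intro ord_ge_mult) (auto simp: residue_kernel_def mem_std_lattice)
    then have "ord_ge 0 (v $ 1 - fls_const ?c * v $ 2)"
      using v by (intro ord_ge_diff) (auto simp: residue_kernel_def mem_std_lattice)
    then show "v \<in> ball_lattice 1 (fls_const ?c)"
      using v lin[of "fls_nth (v $ 1) 0" "fls_nth (v $ 2) 0"]
      by (simp add: ball_lattice_def ord_ge_1_iff residue_kernel_def mem_std_lattice del: fls_const_divide_const fls_const_uminus) }
  { assume v: "v \<in> ball_lattice 1 (fls_const ?c)"
    have "ord_ge (0 + 0) (fls_const ?c * v $ 2)"
      using v by (intro ord_ge_mult) (auto simp: ball_lattice_def)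
    then have "ord_ge 0 ((v $ 1 - fls_const ?c * v $ 2) + fls_const ?c * v $ 2)"
      using v by (intro ord_ge_add) (auto simp: ball_lattice_def ord_ge_1_iff)
    then show "v \<in> residue_kernel \<alpha> \<beta>"
      using v lin[of "fls_nth (v $ 1) 0" "fls_nth (v $ 2) 0"]
      by (simp add: ball_lattice_def ord_ge_1_iff residue_kernel_def mem_std_lattice) }
qed

lemma residue_kernel_eq_scaled_ball:
  assumes "\<beta> \<noteq> 0"
  shows "residue_kernel 0 \<beta> = (*s) fls_X ` ball_lattice (- 1) 0"
proof (intro equalityI subsetI)
  fix v :: "'a fls ^ 2" assume "v \<in> (*s) fls_X ` ball_lattice (- 1) 0"
  then obtain w where w: "v = fls_X *s w" "ord_ge 0 (w $ 2)" "ord_ge (- 1) (w $ 1)"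
    by (auto simp: ball_lattice_def)
  then have "ord_ge 0 (v $ 1)" "ord_ge 1 (v $ 2)"
    by (simp_all flip: pi_pow_1)
  then show "v \<in> residue_kernel 0 \<beta>"
    by (simp add: residue_kernel_def mem_std_lattice ord_ge_1_iff)
next
  fix v :: "'a fls ^ 2" assume "v \<in> residue_kernel 0 \<beta>"
  then have v: "ord_ge 0 (v $ 1)" "ord_ge 1 (v $ 2)"
    using assms by (auto simp: residue_kernel_def mem_std_lattice ord_ge_1_iff)
  define w where "w = pi_pow (- 1) *s v"
  have "v = fls_X *s w"
    using pi_pow_mult_inverse[of 1, where ?'a = 'a] by (simp add: w_def pi_pow_1)
  moreover have "w \<in> ball_lattice (- 1) 0"
    using v by (simp add: w_def ball_lattice_def)
  ultimately show "v \<in> (*s) fls_X ` ball_lattice (- 1) 0" by blast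
qed

lemma scale_eq_matrix: "(c :: 'b::field) *s v = (mat c :: 'b ^ 2 ^ 2) *v v"
  by (simp add: vec2_eq_iff matrix_vector_mult_2 mat_def)

lemma invertible_scale:
  assumes "(c :: 'b::field) \<noteq> 0"
  shows "invertible (mat c :: 'b ^ 2 ^ 2)"
  unfolding invertible_def using assms
  by (intro exI[of _ "mat (inverse c)"]) (simp add: matrix2_eq_iff matrix_matrix_mult_2 mat_def)

lemma scale_image_eq_matrix: "(*s) (c :: 'b::field) ` L = (*v) (mat c :: 'b ^ 2 ^ 2) ` L"
  by (simp add: scale_eq_matrix)

lemma lattice_residue_kernel:
  assumes "(\<alpha>, \<beta>) \<noteq> (0, 0)"
  shows "lattice (residue_kernel \<alpha> \<beta>)"
proof (cases "\<alpha> = 0")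
  case True
  then have "residue_kernel \<alpha> \<beta> = (*v) (mat fls_X) ` ball_lattice (- 1) 0"
    using assms by (simp add: residue_kernel_eq_scaled_ball scale_image_eq_matrix)
  then show ?thesis
    by (simp add: lattice_image invertible_scale lattice_ball)
qed (simp add: residue_kernel_eq_ball lattice_ball)

lemma fls_nth_0_fps_mult:
  "ord_ge 0 x \<Longrightarrow> fls_nth (fps_to_fls a * x) 0 = fps_nth a 0 * fls_nth x 0"
  by (auto simp: ord_ge_0_iff simp flip: fls_times_fps_to_fls)

text \<open>
  The linear form itself, evaluated on representatives of cosets, is the isomorphism from the
  quotient to the residue field.
\<close>

lemma index_q_residue_kernel:
  assumes nz: "(\<alpha>, \<beta>) \<noteq> (0, 0)"
  shows "index_q_sublattice (std_lattice :: ('a::{field,finite} fls ^ 2) set) (residue_kernel \<alpha> \<beta>)"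
proof -
  define K where "K = residue_kernel \<alpha> \<beta>"
  define \<rho> where "\<rho> v = \<alpha> * fls_nth (v $ 1) 0 + \<beta> * fls_nth (v $ 2) 0" for v :: "'a fls ^ 2"
  have K: "v \<in> K \<longleftrightarrow> v \<in> std_lattice \<and> \<rho> v = 0" for v
    by (simp add: K_def residue_kernel_def \<rho>_def)
  have \<rho>_add: "\<rho> (v + w) = \<rho> v + \<rho> w" and \<rho>_diff: "\<rho> (v - w) = \<rho> v - \<rho> w" for v w
    by (simp_all add: \<rho>_def algebra_simps)
  have std_add: "v + w \<in> std_lattice" and std_diff: "v - w \<in> std_lattice"
    if "v \<in> std_lattice" "w \<in> std_lattice" for v w :: "'a fls ^ 2"
    using that by (auto simp: mem_std_lattice intro: ord_ge_add ord_ge_diff)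
  have std_scale: "fps_to_fls a *s v \<in> std_lattice" if "v \<in> std_lattice" for a and v :: "'a fls ^ 2"
    using that ord_ge_mult[of 0 "fps_to_fls a" 0] by (auto simp: mem_std_lattice ord_ge_0_iff[of "fps_to_fls a"])
  \<comment> \<open>A vector on which the form is \<open>1\<close>: it gives surjectivity and properness of the kernel.\<close>
  obtain v1 :: "'a fls ^ 2" where v1: "v1 \<in> std_lattice" "\<rho> v1 = 1"
  proof (cases "\<alpha> = 0")
    case True
    then show thesis
      using nz by (intro that[of "vector [0, fls_const (1 / \<beta>)]"]) (auto simp: \<rho>_def mem_std_lattice simp del: fls_const_divide_const)
  next
    case False
    then show thesis
      by (intro that[of "vector [fls_const (1 / \<alpha>), 0]"]) (auto simp: \<rho>_def mem_std_lattice simp del: fls_const_divide_const)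
  qed
  \<comment> \<open>The kernel also properly contains \<open>\<pi>\<close> times the lattice, by a vector with nonzero reduction.\<close>
  obtain v0 :: "'a fls ^ 2" where v0: "v0 \<in> K" "v0 \<notin> (*s) fls_X ` std_lattice"
  proof
    show "vector [fls_const \<beta>, fls_const (- \<alpha>)] \<in> K"
      by (simp add: K mem_std_lattice \<rho>_def del: fls_const_uminus)
    show "vector [fls_const \<beta>, fls_const (- \<alpha>)] \<notin> (*s) fls_X ` std_lattice"
    proof
      assume "vector [fls_const \<beta>, fls_const (- \<alpha>)] \<in> (*s) fls_X ` std_lattice"
      then obtain w :: "'a fls ^ 2" where w: "w \<in> std_lattice"
          "fls_const \<beta> = pi_pow 1 * w $ 1" "fls_const (- \<alpha>) = pi_pow 1 * w $ 2"
        by (auto simp: vec2_eq_iff pi_pow_1)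
      then have "ord_ge 1 (fls_const \<beta>)" "ord_ge 1 (fls_const (- \<alpha>))"
        by (simp_all add: mem_std_lattice)
      then show False
        using nz by (simp add: ord_ge_1_iff del: fls_const_uminus)
    qed
  qed
  have "(*s) fls_X ` std_lattice \<subseteq> K"
  proof clarify
    fix w :: "'a fls ^ 2" assume "w \<in> std_lattice"
    then have "ord_ge 1 (pi_pow 1 * w $ 1)" "ord_ge 1 (pi_pow 1 * w $ 2)"
      by (simp_all add: mem_std_lattice)
    then show "fls_X *s w \<in> K"
      unfolding pi_pow_1 by (simp add: K mem_std_lattice \<rho>_def ord_ge_1_iff)
  qed
  moreover have "K \<subset> std_lattice"
    using v1 K by (metis psubsetI subsetI zero_neq_one)
  moreover have "quotient_iso_residue_field std_lattice K"
    unfolding quotient_iso_residue_field_def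
  proof (intro exI conjI ballI allI)
    define \<phi> where "\<phi> C = \<rho> (SOME v. v \<in> C)" for C :: "('a fls ^ 2) set"
    have \<phi>: "\<phi> (coset K x) = \<rho> x" if "x \<in> std_lattice" for x
    proof -
      have "x + 0 \<in> coset K x"
        unfolding coset_def by (intro imageI) (simp add: K mem_std_lattice \<rho>_def)
      then have "(SOME v. v \<in> coset K x) \<in> coset K x"
        by (rule someI)
      then show ?thesis
        by (auto simp: \<phi>_def coset_def K \<rho>_add)
    qed
    show "bij_betw \<phi> (coset K ` std_lattice) UNIV"
      unfolding bij_betw_def
    proof
      show "inj_on \<phi> (coset K ` std_lattice)"
      proof (rule inj_onI)
        fix C D assume "C \<in> coset K ` std_lattice" "D \<in> coset K ` std_lattice" "\<phi> C = \<phi> D"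
        then obtain x y where xy: "C = coset K x" "D = coset K y" "x \<in> std_lattice" "y \<in> std_lattice" "\<rho> x = \<rho> y"
          by (auto simp: \<phi>)
        have sub: "coset K x \<subseteq> coset K y" if "x \<in> std_lattice" "y \<in> std_lattice" "\<rho> x = \<rho> y" for x y
        proof
          fix z assume "z \<in> coset K x"
          then obtain k where "z = x + k" "k \<in> K" by (auto simp: coset_def)
          then have "z = y + ((x - y) + k)" "(x - y) + k \<in> K"
            using that by (auto simp: K \<rho>_add \<rho>_diff intro!: std_add std_diff)
          then show "z \<in> coset K y" unfolding coset_def by blast
        qed
        show "C = D"
          unfolding xy using sub xy(3-5) by (metis subset_antisym)
      qed
      have "\<rho> (fps_to_fls (fps_const a) *s v1) = a * \<rho> v1" for a
        by (simp add: \<rho>_def algebra_simps)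
      then have "\<exists>x\<in>std_lattice. \<rho> x = a" for a
        using v1(2) std_scale[OF v1(1)] by (metis mult.right_neutral)
      then have "\<exists>x\<in>std_lattice. a = \<phi> (coset K x)" for a
        using \<phi> by metis
      then show "\<phi> ` coset K ` std_lattice = UNIV"
        by blast
    qed
    fix x y :: "'a fls ^ 2" assume x: "x \<in> std_lattice"
    { fix a
      show "\<phi> (coset K (fps_to_fls a *s x)) = fps_nth a 0 * \<phi> (coset K x)"
        using x std_scale[OF x] by (simp add: \<phi> \<rho>_def mem_std_lattice fls_nth_0_fps_mult algebra_simps) }
    { assume "y \<in> std_lattice"
      then show "\<phi> (coset K (x + y)) = \<phi> (coset K x) + \<phi> (coset K y)"
        using x std_add[of x y] by (simp add: \<phi> \<rho>_add) }
  qed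
  ultimately show ?thesis
    using v0 lattice_residue_kernel[OF nz] lattice_ball[of 0 0]
    unfolding index_q_sublattice_def K_def[symmetric] std_lattice_eq_ball by blast
qed

lemma lattice_closed:
  assumes "lattice L"
  shows "0 \<in> L" "x \<in> L \<Longrightarrow> y \<in> L \<Longrightarrow> x + y \<in> L" "x \<in> L \<Longrightarrow> y \<in> L \<Longrightarrow> x - y \<in> L"
proof -
  obtain u w where L: "L = {fps_to_fls a *s u + fps_to_fls b *s w | a b. True}"
    using assms unfolding lattice_def by blast
  have mem: "fps_to_fls a *s u + fps_to_fls b *s w \<in> L" for a b
    unfolding L by blast
  show "0 \<in> L"
    using mem[of 0 0] by simp
  assume "x \<in> L" "y \<in> L"
  then obtain a b c d where xy: "x = fps_to_fls a *s u + fps_to_fls b *s w"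
      "y = fps_to_fls c *s u + fps_to_fls d *s w"
    unfolding L by blast
  show "x + y \<in> L"
    using mem[of "a + c" "b + d"] by (simp add: xy vector_sadd_rdistrib algebra_simps)
  show "x - y \<in> L"
    using mem[of "a - c" "b - d"] by (simp add: xy vec.scale_left_diff_distrib algebra_simps)
qed

text \<open>
  Conversely, an isomorphism of the quotient with the residue field, composed with the projection,
  is semilinear along the residue map, hence given by its values on the two unit vectors.
\<close>

lemma index_q_sublattice_std_imp:
  fixes L' :: "('a::{field,finite} fls ^ 2) set"
  assumes "index_q_sublattice std_lattice L'"
  shows "\<exists>\<alpha> \<beta>. (\<alpha>, \<beta>) \<noteq> (0, 0) \<and> L' = residue_kernel \<alpha> \<beta>"
proof -
  have L': "lattice L'" "L' \<subseteq> std_lattice"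
    using assms by (auto simp: index_q_sublattice_def)
  obtain \<phi> :: "('a fls ^ 2) set \<Rightarrow> 'a" where
    bij: "bij_betw \<phi> (coset L' ` std_lattice) UNIV" and
    add: "\<And>x y. x\<in>std_lattice \<Longrightarrow> y\<in>std_lattice \<Longrightarrow> \<phi> (coset L' (x + y)) = \<phi> (coset L' x) + \<phi> (coset L' y)" and
    scale: "\<And>a x. x\<in>std_lattice \<Longrightarrow> \<phi> (coset L' (fps_to_fls a *s x)) = fps_nth a 0 * \<phi> (coset L' x)"
    using assms unfolding index_q_sublattice_def quotient_iso_residue_field_def by blast
  define \<psi> where "\<psi> x = \<phi> (coset L' x)" for x
  define e1 :: "'a fls ^ 2" where "e1 = vector [1, 0]"
  define e2 :: "'a fls ^ 2" where "e2 = vector [0, 1]"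
  have e: "e1 \<in> std_lattice" "e2 \<in> std_lattice" "0 \<in> std_lattice"
    by (auto simp: e1_def e2_def mem_std_lattice) (auto simp: ord_ge_def)
  have \<psi>_eq: "\<psi> v = \<psi> e1 * fls_nth (v $ 1) 0 + \<psi> e2 * fls_nth (v $ 2) 0" if v: "v \<in> std_lattice" for v
  proof -
    obtain a b where ab: "v $ 1 = fps_to_fls a" "v $ 2 = fps_to_fls b"
      using v by (auto simp: mem_std_lattice ord_ge_0_iff)
    have "v = fps_to_fls a *s e1 + fps_to_fls b *s e2"
      by (simp add: vec2_eq_iff ab e1_def e2_def)
    moreover have "fps_to_fls a *s e1 \<in> std_lattice" "fps_to_fls b *s e2 \<in> std_lattice"
      by (auto simp: mem_std_lattice e1_def e2_def ord_ge_0_iff)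
    ultimately have "\<psi> v = \<psi> (fps_to_fls a *s e1) + \<psi> (fps_to_fls b *s e2)"
      by (simp only: \<psi>_def add)
    also have "\<dots> = fps_nth a 0 * \<psi> e1 + fps_nth b 0 * \<psi> e2"
      using e by (simp only: \<psi>_def scale)
    finally show ?thesis
      by (simp add: ab)
  qed
  have "\<psi> 0 = 0"
    using \<psi>_eq[OF e(3)] by simp
  have coset_eq: "coset L' x = coset L' 0 \<longleftrightarrow> x \<in> L'" for x
  proof
    assume "coset L' x = coset L' 0"
    moreover have "x + 0 \<in> coset L' x"
      unfolding coset_def using lattice_closed(1)[OF L'(1)] by blast
    ultimately show "x \<in> L'"
      by (auto simp: coset_def)
  next
    assume x: "x \<in> L'"
    show "coset L' x = coset L' 0"
    proof (intro equalityI subsetI)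
      fix z assume "z \<in> coset L' x"
      then show "z \<in> coset L' 0"
        using x lattice_closed(2)[OF L'(1)] by (auto simp: coset_def)
    next
      fix z assume "z \<in> coset L' 0"
      then have "z - x \<in> L'"
        using x lattice_closed(3)[OF L'(1)] by (auto simp: coset_def)
      moreover have "z = x + (z - x)" by simp
      ultimately show "z \<in> coset L' x"
        unfolding coset_def by blast
    qed
  qed
  have "\<psi> x = 0 \<longleftrightarrow> x \<in> L'" if "x \<in> std_lattice" for x
  proof -
    have "\<psi> x = \<psi> 0 \<longleftrightarrow> coset L' x = coset L' 0"
      unfolding \<psi>_def using bij that e(3) by (intro inj_on_eq_iff[of \<phi> "coset L' ` std_lattice"]) (auto simp: bij_betw_def)
    then show ?thesis
      using \<open>\<psi> 0 = 0\<close> coset_eq by simp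
  qed
  then have "L' = residue_kernel (\<psi> e1) (\<psi> e2)"
    using L'(2) \<psi>_eq by (auto simp: residue_kernel_def)
  moreover have "1 \<in> \<phi> ` coset L' ` std_lattice"
    using bij by (simp add: bij_betw_def)
  then obtain v where "v \<in> std_lattice" "\<psi> v = 1"
    by (auto simp: \<psi>_def)
  then have "(\<psi> e1, \<psi> e2) \<noteq> (0, 0)"
    using \<psi>_eq by force
  ultimately show ?thesis by blast
qed

section \<open>Adjacency in ball coordinates\<close>

text \<open>
  The form \<open>(0, 1)\<close> yields the parent and the forms \<open>(1, -a)\<close> yield the children.
\<close>

lemma adjacent_origin_iff:
  "adjacent (ball_vertex 0 0) y \<longleftrightarrow> y = ball_vertex (- 1) 0 \<or> (\<exists>a. y = ball_vertex 1 (fls_const a))"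
proof -
  have "adjacent (ball_vertex 0 0) y \<longleftrightarrow>
      (\<exists>L'. y = homothety_class L' \<and> index_q_sublattice std_lattice L')"
  proof
    assume "adjacent (ball_vertex 0 0) y"
    then obtain L L' where L: "homothety_class std_lattice = homothety_class L"
        "y = homothety_class L'" "index_q_sublattice L L'"
      unfolding adjacent_iff_sublattice ball_vertex_def std_lattice_eq_ball by blast
    then obtain c where c: "c \<noteq> 0" "L = (*s) c ` std_lattice"
      unfolding homothety_class_eq_iff by blast
    have std: "std_lattice = (*s) (inverse c) ` L"
      unfolding c(2) image_image using c(1) by simp
    have "index_q_sublattice ((*s) (inverse c) ` L) ((*s) (inverse c) ` L')"
      unfolding scale_image_eq_matrix using L(3) c(1) by (intro index_q_sublattice_image invertible_scale) auto
    moreover have "y = homothety_class ((*s) (inverse c) ` L')"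
      using L(2) c(1) by (simp add: homothety_class_scale)
    ultimately show "\<exists>L'. y = homothety_class L' \<and> index_q_sublattice std_lattice L'"
      unfolding std[symmetric] by blast
  next
    assume "\<exists>L'. y = homothety_class L' \<and> index_q_sublattice std_lattice L'"
    then show "adjacent (ball_vertex 0 0) y"
      unfolding adjacent_iff_sublattice ball_vertex_def std_lattice_eq_ball by blast
  qed
  also have "\<dots> \<longleftrightarrow> (\<exists>\<alpha> \<beta>. (\<alpha>, \<beta>) \<noteq> (0, 0) \<and> y = homothety_class (residue_kernel \<alpha> \<beta>))"
  proof
    assume "\<exists>L'. y = homothety_class L' \<and> index_q_sublattice std_lattice L'"
    then obtain L' where "y = homothety_class L'" "index_q_sublattice std_lattice L'" by blast
    with index_q_sublattice_std_imp[of L'] show "\<exists>\<alpha> \<beta>. (\<alpha>, \<beta>) \<noteq> (0, 0) \<and> y = homothety_class (residue_kernel \<alpha> \<beta>)"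
      by blast
  next
    assume "\<exists>\<alpha> \<beta>. (\<alpha>, \<beta>) \<noteq> (0, 0) \<and> y = homothety_class (residue_kernel \<alpha> \<beta>)"
    then obtain \<alpha> \<beta> where "(\<alpha>, \<beta>) \<noteq> (0, 0)" "y = homothety_class (residue_kernel \<alpha> \<beta>)" by blast
    with index_q_residue_kernel[of \<alpha> \<beta>] show "\<exists>L'. y = homothety_class L' \<and> index_q_sublattice std_lattice L'"
      by blast
  qed
  also have "\<dots> \<longleftrightarrow> y = ball_vertex (- 1) 0 \<or> (\<exists>a. y = ball_vertex 1 (fls_const a))"
  proof -
    have 0: "homothety_class (residue_kernel 0 \<beta>) = ball_vertex (- 1) 0" if "\<beta> \<noteq> 0" for \<beta> :: 'a
      using that by (simp add: residue_kernel_eq_scaled_ball homothety_class_scale ball_vertex_def)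
    have 1: "homothety_class (residue_kernel \<alpha> \<beta>) = ball_vertex 1 (fls_const (- \<beta> / \<alpha>))"
      if "\<alpha> \<noteq> 0" for \<alpha> \<beta> :: 'a
      unfolding ball_vertex_def residue_kernel_eq_ball[OF that] ..
    show ?thesis
    proof
      assume "\<exists>\<alpha> \<beta>. (\<alpha>, \<beta>) \<noteq> (0, 0) \<and> y = homothety_class (residue_kernel \<alpha> \<beta>)"
      then obtain \<alpha> \<beta> where y: "(\<alpha>, \<beta>) \<noteq> (0, 0)" "y = homothety_class (residue_kernel \<alpha> \<beta>)" by blast
      show "y = ball_vertex (- 1) 0 \<or> (\<exists>a. y = ball_vertex 1 (fls_const a))"
        using y 0 1 by (cases "\<alpha> = 0") blast+
    next
      assume "y = ball_vertex (- 1) 0 \<or> (\<exists>a. y = ball_vertex 1 (fls_const a))"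
      then show "\<exists>\<alpha> \<beta>. (\<alpha>, \<beta>) \<noteq> (0, 0) \<and> y = homothety_class (residue_kernel \<alpha> \<beta>)"
      proof
        assume "y = ball_vertex (- 1) 0"
        then show ?thesis using 0[of 1] by (intro exI[of _ 0] exI[of _ 1]) simp
      next
        assume "\<exists>a. y = ball_vertex 1 (fls_const a)"
        then obtain a where "y = ball_vertex 1 (fls_const a)" by blast
        then show ?thesis using 1[of 1 "- a"] by (intro exI[of _ 1] exI[of _ "- a"]) simp
      qed
    qed
  qed
  finally show ?thesis .
qed

text \<open>
  Every ball vertex is the image of the standard vertex under its matrix, so this is
  transported from the standard vertex.
\<close>

lemma adjacent_ball_iff:
  "adjacent (ball_vertex m b) y \<longleftrightarrow>
    y = ball_vertex (m - 1) b \<or> (\<exists>a. y = ball_vertex (m + 1) (b + fls_const a * pi_pow m))"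
proof -
  have nbr: "act (ball_matrix m b) (ball_vertex (- 1) 0) = ball_vertex (m - 1) b"
      "act (ball_matrix m b) (ball_vertex 1 (fls_const a)) = ball_vertex (m + 1) (b + fls_const a * pi_pow m)" for a
    by (simp_all add: act_ball_matrix mult.commute)
  have "adjacent (ball_vertex m b) y \<longleftrightarrow> (\<exists>y'. y = act (ball_matrix m b) y' \<and> adjacent (ball_vertex 0 0) y')"
    using adjacent_act_iff[OF invertible_ball_matrix, of m b "ball_vertex 0 0" y] by (simp add: act_ball_matrix)
  then show ?thesis
    unfolding adjacent_origin_iff nbr[symmetric] by blast
qed

lemma adjacent_imp_ball: "adjacent x y \<Longrightarrow> \<exists>m b. x = ball_vertex m b"
  unfolding adjacent_def using lattice_class_is_ball by blast

lemma adjacent_sym: "adjacent x y \<Longrightarrow> adjacent y x"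
proof -
  assume "adjacent x y"
  then obtain m b where x: "x = ball_vertex m b" "adjacent (ball_vertex m b) y"
    using adjacent_imp_ball by blast
  then consider "y = ball_vertex (m - 1) b" | a where "y = ball_vertex (m + 1) (b + fls_const a * pi_pow m)"
    unfolding adjacent_ball_iff by blast
  then show "adjacent y x"
  proof cases
    case 1
    then show ?thesis
      unfolding x(1) 1 adjacent_ball_iff by (intro disjI2 exI[of _ 0]) simp
  next
    case 2
    have "ord_ge (0 + m) (fls_const a * pi_pow m)"
      by (intro ord_ge_mult) auto
    then have "x = ball_vertex (m + 1 - 1) (b + fls_const a * pi_pow m)"
      unfolding x(1) ball_vertex_eq_iff by simp
    then show ?thesis
      unfolding 2 adjacent_ball_iff by blast
  qed
qed

section \<open>Polynomial matrices and the uniqueness of heights\<close>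

lemma poly_to_fls_0 [simp]: "poly_to_fls 0 = 0"
  by (simp add: poly_to_fls_def)

lemma poly_to_fls_pCons: "poly_to_fls (pCons a p) = fls_const a + fls_X_inv * poly_to_fls p"
  by (simp add: poly_to_fls_def map_poly_pCons)

lemma poly_to_fls_1 [simp]: "poly_to_fls 1 = 1"
  by (simp add: poly_to_fls_def)

lemma poly_to_fls_add: "poly_to_fls (p + q) = poly_to_fls p + poly_to_fls q"
  by (induction p q rule: poly_induct2) (simp_all add: poly_to_fls_pCons algebra_simps flip: fls_plus_const)

lemma poly_to_fls_smult: "poly_to_fls (smult a p) = fls_const a * poly_to_fls p"
  by (induction p) (simp_all add: poly_to_fls_pCons algebra_simps flip: fls_const_mult_const)

lemma poly_to_fls_mult: "poly_to_fls (p * q) = poly_to_fls p * poly_to_fls q"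
  by (induction p) (simp_all add: poly_to_fls_pCons poly_to_fls_add poly_to_fls_smult algebra_simps)

text \<open>
  A polynomial in \<open>t\<close> has its coefficients at the nonpositive powers of \<open>\<pi>\<close>.
\<close>

lemma fls_nth_poly_to_fls: "fls_nth (poly_to_fls p) k = (if k \<le> 0 then coeff p (nat (- k)) else 0)"
proof (induction p arbitrary: k)
  case (pCons a p)
  have "fls_nth (poly_to_fls (pCons a p)) k = (if k = 0 then a else 0) + fls_nth (poly_to_fls p) (k + 1)"
    by (simp add: poly_to_fls_pCons fls_X_inv_times_conv_shift)
  also have "\<dots> = (if k \<le> 0 then coeff (pCons a p) (nat (- k)) else 0)"
  proof (cases "k < 0")
    case True
    then have "nat (- k) = Suc (nat (- (k + 1)))" by simp
    with True show ?thesis unfolding pCons.IH by simp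
  qed (auto simp: pCons.IH)
  finally show ?case .
qed simp

lemma poly_to_fls_eq_0_if_small:
  assumes "ord_ge 1 (poly_to_fls p)"
  shows "p = 0"
proof (rule poly_eqI)
  fix n
  have "fls_nth (poly_to_fls p) (- int n) = 0"
    using assms by (auto simp: ord_ge_iff_nth)
  then show "coeff p n = coeff 0 n"
    by (simp add: fls_nth_poly_to_fls)
qed

lemma poly_to_fls_monom: "poly_to_fls (monom a n) = fls_const a * pi_pow (- int n)"
proof (induction n)
  case 0
  then show ?case by (simp add: monom_0 poly_to_fls_pCons)
next
  case (Suc n)
  have "pi_pow (- int (Suc n)) = pi_pow (- 1) * (pi_pow (- int n) :: 'a fls)"
    by (simp flip: pi_pow_add)
  moreover have "fls_X_inv = (pi_pow (- 1) :: 'a fls)"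
    by (simp add: pi_pow_def fls_X_inv_conv_shift_1)
  ultimately show ?case
    using Suc by (simp add: monom_Suc poly_to_fls_pCons mult.left_commute)
qed

lemma map_matrix_poly_to_fls_mult:
  fixes g h :: "'a::{field,finite} poly ^ 2 ^ 2"
  shows "map_matrix poly_to_fls (g ** h) = map_matrix poly_to_fls g ** map_matrix poly_to_fls h"
  by (simp add: matrix2_eq_iff matrix_matrix_mult_2 poly_to_fls_add poly_to_fls_mult)

lemma map_matrix_poly_to_fls_1: "map_matrix poly_to_fls (mat 1) = (mat 1 :: 'a::{field,finite} fls ^ 2 ^ 2)"
  by (simp add: matrix2_eq_iff mat_def)

lemma invertible_map_matrix_poly_to_fls:
  "invertible (g :: 'a::{field,finite} poly ^ 2 ^ 2) \<Longrightarrow> invertible (map_matrix poly_to_fls g)"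
  unfolding invertible_def by (metis map_matrix_poly_to_fls_1 map_matrix_poly_to_fls_mult)

lemma orbit_refl: "x \<in> orbit x"
  unfolding orbit_def
  by (intro CollectI exI[of _ "mat 1"]) (simp add: map_matrix_poly_to_fls_1 invertible_def exI[of _ "mat 1"])

lemma orbit_trans: "x \<in> orbit y \<Longrightarrow> y \<in> orbit z \<Longrightarrow> x \<in> orbit z"
  unfolding orbit_def
  by clarify (metis act_mult invertible_mult map_matrix_poly_to_fls_mult)

lemma orbit_sym: "x \<in> orbit y \<Longrightarrow> y \<in> orbit x"
proof -
  assume "x \<in> orbit y"
  then obtain g h :: "'a poly ^ 2 ^ 2" where g: "g ** h = mat 1" "h ** g = mat 1"
      and x: "x = act (map_matrix poly_to_fls g) y"
    unfolding orbit_def invertible_def by blast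
  have "y = act (map_matrix poly_to_fls h) x"
    unfolding x act_mult[symmetric] map_matrix_poly_to_fls_mult[symmetric] g map_matrix_poly_to_fls_1 by simp
  moreover have "invertible h"
    using g unfolding invertible_def by blast
  ultimately show "y \<in> orbit x"
    unfolding orbit_def by blast
qed

lemma orbit_translate: "ball_vertex m (b + poly_to_fls p) \<in> orbit (ball_vertex m b)"
proof -
  define g :: "'a poly ^ 2 ^ 2" where "g = vector [vector [1, p], vector [0, 1]]"
  have "map_matrix poly_to_fls g = ball_matrix 0 (poly_to_fls p)"
    by (simp add: matrix2_eq_iff g_def ball_matrix_def)
  then have "ball_vertex m (b + poly_to_fls p) = act (map_matrix poly_to_fls g) (ball_vertex m b)"
    by (simp add: act_ball_matrix add.commute)
  moreover have "invertible g"
    unfolding invertible_def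
    by (intro exI[of _ "vector [vector [1, - p], vector [0, 1]]"])
      (simp add: matrix2_eq_iff matrix_matrix_mult_2 g_def mat_def)
  ultimately show ?thesis
    unfolding orbit_def by blast
qed

lemma orbit_swap: "ball_vertex (- m) 0 \<in> orbit (ball_vertex m 0)"
proof -
  define g :: "'a poly ^ 2 ^ 2" where "g = vector [vector [0, 1], vector [1, 0]]"
  have g: "invertible g"
    unfolding invertible_def
    by (intro exI[of _ g]) (simp add: matrix2_eq_iff matrix_matrix_mult_2 g_def mat_def)
  have "(*v) (map_matrix poly_to_fls g) ` ball_lattice m 0 = (*s) (pi_pow m) ` ball_lattice (- m) 0"
  proof (intro equalityI subsetI)
    fix w assume "w \<in> (*v) (map_matrix poly_to_fls g) ` ball_lattice m (0 :: 'a fls)"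
    then obtain v where v: "v \<in> ball_lattice m (0 :: 'a fls)" "w = map_matrix poly_to_fls g *v v" by blast
    have "w = pi_pow m *s (pi_pow (- m) *s w)"
      by (simp add: pi_pow_mult_inverse)
    moreover have "pi_pow (- m) *s w \<in> ball_lattice (- m) 0"
      using v by (simp add: ball_lattice_def g_def matrix_vector_mult_2)
    ultimately show "w \<in> (*s) (pi_pow m) ` ball_lattice (- m) 0" by blast
  next
    fix w assume "w \<in> (*s) (pi_pow m) ` ball_lattice (- m) (0 :: 'a fls)"
    then obtain v where v: "v \<in> ball_lattice (- m) (0 :: 'a fls)" "w = pi_pow m *s v" by blast
    define u :: "'a fls ^ 2" where "u = vector [w $ 2, w $ 1]"
    have "w = map_matrix poly_to_fls g *v u"
      by (simp add: vec2_eq_iff u_def g_def matrix_vector_mult_2)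
    moreover have "u \<in> ball_lattice m 0"
      using v by (simp add: u_def ball_lattice_def)
    ultimately show "w \<in> (*v) (map_matrix poly_to_fls g) ` ball_lattice m 0" by blast
  qed
  then have "act (map_matrix poly_to_fls g) (ball_vertex m 0) = ball_vertex (- m) 0"
    by (simp add: ball_vertex_def act_homothety_class homothety_class_scale)
  then show ?thesis
    unfolding orbit_def using g by blast
qed

text \<open>
  The columns of \<open>g\<close>, suitably scaled, lie in the image of the lattice of \<open>v\<^sub>n\<close>, hence in
  that of \<open>v\<^sub>m\<close> up to the scalar \<open>s\<close>.  This bounds the degrees of the entries.  If the order of
  \<open>s\<close> exceeds \<open>0\<close>, the bottom row consists of polynomials of negative degree; if it exceeds
  \<open>m - n\<close>, the first column does.  Either contradicts invertibility.
\<close>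

lemma polynomial_matrix_degree_bound:
  fixes g :: "'a::{field,finite} poly ^ 2 ^ 2"
  assumes g: "invertible g" and s: "s \<noteq> 0"
    and sub: "(*v) (map_matrix poly_to_fls g) ` ball_lattice (- int n) 0 \<subseteq> (*s) s ` ball_lattice (- int m) 0"
  shows "fls_subdegree s \<le> 0" "fls_subdegree s \<le> int m - int n"
proof -
  obtain h where h: "g ** h = mat 1" "h ** g = mat 1"
    using g unfolding invertible_def by blast
  let ?G = "map_matrix poly_to_fls g"
  have bound: "ord_ge (fls_subdegree s - int m) ((?G *v v) $ 1) \<and> ord_ge (fls_subdegree s) ((?G *v v) $ 2)"
    if v: "v \<in> ball_lattice (- int n) 0" for v
  proof -
    obtain w where w: "?G *v v = s *s w" "w \<in> ball_lattice (- int m) 0"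
      using subsetD[OF sub imageI[OF v]] by (elim imageE) blast
    have s': "ord_ge (fls_subdegree s) s" by (simp add: ord_ge_def)
    show ?thesis
      unfolding w(1) using w(2) ord_ge_mult[OF s', of "- int m" "w $ 1"] ord_ge_mult[OF s', of 0 "w $ 2"]
      by (simp add: ball_lattice_def)
  qed
  \<comment> \<open>These two vectors pick out the columns of \<open>g\<close>, the first one up to a power of \<open>t\<close>.\<close>
  have e1: "vector [pi_pow (- int n), 0] \<in> ball_lattice (- int n) (0 :: 'a fls)"
    and e2: "vector [0, 1] \<in> ball_lattice (- int n) (0 :: 'a fls)"
    by (simp_all add: ball_lattice_def) (simp add: ord_ge_def)
  have "ord_ge (fls_subdegree s - int m) (pi_pow (- int n) * poly_to_fls (g $ 1 $ 1))"
    "ord_ge (fls_subdegree s) (pi_pow (- int n) * poly_to_fls (g $ 2 $ 1))"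
    "ord_ge (fls_subdegree s) (poly_to_fls (g $ 2 $ 2))"
    using bound[OF e1] bound[OF e2] by (simp_all add: matrix_vector_mult_2 mult.commute)
  then have ord: "ord_ge (fls_subdegree s - int m + int n) (poly_to_fls (g $ 1 $ 1))"
    "ord_ge (fls_subdegree s + int n) (poly_to_fls (g $ 2 $ 1))"
    "ord_ge (fls_subdegree s) (poly_to_fls (g $ 2 $ 2))"
    by simp_all
  show "fls_subdegree s \<le> 0"
  proof (rule ccontr)
    assume "\<not> ?thesis"
    then have "g $ 2 $ 1 = 0" "g $ 2 $ 2 = 0"
      using ord(2,3) by (auto intro!: poly_to_fls_eq_0_if_small elim: ord_ge_mono)
    then have "(g ** h) $ 2 $ 2 = 0"
      by (simp add: matrix_matrix_mult_2)
    then show False unfolding h by (simp add: mat_def)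
  qed
  show "fls_subdegree s \<le> int m - int n"
  proof (rule ccontr)
    assume "\<not> ?thesis"
    then have "g $ 1 $ 1 = 0" "g $ 2 $ 1 = 0"
      using ord(1,2) by (auto intro!: poly_to_fls_eq_0_if_small elim: ord_ge_mono)
    then have "(h ** g) $ 1 $ 1 = 0"
      by (simp add: matrix_matrix_mult_2)
    then show False unfolding h by (simp add: mat_def)
  qed
qed

text \<open>
  The degree bounds for \<open>g\<close> and for its inverse, whose scalars are inverse to each other, force the
  order of the scalar and the difference \<open>m - n\<close> to vanish.
\<close>

lemma std_vertex_orbit_inj:
  assumes "std_vertex m \<in> orbit (std_vertex n :: 'a::{field,finite} vertex)"
  shows "m = n"
proof -
  obtain g h :: "'a poly ^ 2 ^ 2" where gh: "g ** h = mat 1" "h ** g = mat 1"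
      and "std_vertex m = act (map_matrix poly_to_fls g) (std_vertex n)"
    using assms unfolding orbit_def invertible_def by blast
  then have "homothety_class ((*v) (map_matrix poly_to_fls g) ` ball_lattice (- int n) 0)
      = homothety_class (ball_lattice (- int m) 0)"
    by (simp add: std_vertex_eq_ball ball_vertex_def act_homothety_class)
  then obtain c where c: "c \<noteq> 0" "ball_lattice (- int m) 0 =
      (*s) c ` (*v) (map_matrix poly_to_fls g) ` ball_lattice (- int n) 0"
    unfolding homothety_class_eq_iff by blast
  define s where "s = inverse c"
  have s: "s \<noteq> 0" "s * c = 1"
    using c(1) by (simp_all add: s_def)
  have G: "(*v) (map_matrix poly_to_fls g) ` ball_lattice (- int n) 0 = (*s) s ` ball_lattice (- int m) 0"
    unfolding c(2) image_image using s by simp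
  have "map_matrix poly_to_fls h *v (map_matrix poly_to_fls g *v v) = v" for v
    unfolding matrix_vector_mul_assoc map_matrix_poly_to_fls_mult[symmetric] gh map_matrix_poly_to_fls_1 by simp
  then have H: "(*v) (map_matrix poly_to_fls h) ` ball_lattice (- int m) 0 = (*s) c ` ball_lattice (- int n) 0"
    unfolding c(2) image_image by (simp add: vector_scalar_commute)
  have inv: "invertible g" "invertible h"
    using gh unfolding invertible_def by blast+
  have "fls_subdegree (s * c) = 0"
    by (simp add: s(2))
  then have "fls_subdegree s + fls_subdegree c = 0"
    using s(1) c(1) by simp
  then show ?thesis
    using polynomial_matrix_degree_bound[OF inv(1) s(1), of n m] polynomial_matrix_degree_bound[OF inv(2) c(1), of m n] G H
    by simp
qed

lemma height_eqI: "x \<in> orbit (std_vertex n) \<Longrightarrow> height x = n"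
  unfolding height_def using std_vertex_orbit_inj orbit_sym orbit_trans by (intro the_equality) blast+

section \<open>Heights of neighbours\<close>

lemma neighbour_of_std_vertex:
  "adjacent (std_vertex n) y \<longleftrightarrow> y = std_vertex (Suc n) \<or>
    (\<exists>a. y = ball_vertex (1 - int n) (poly_to_fls (monom a n)))"
proof -
  have "- int n - 1 = - int (Suc n)" "- int n + 1 = 1 - int n" by simp_all
  then show ?thesis
    by (simp only: std_vertex_eq_ball adjacent_ball_iff poly_to_fls_monom add_0)
qed

text \<open>
  Translation by a polynomial moves a child to the ball around \<open>0\<close>.  For \<open>n = 0\<close> that ball has radius
  below that of \<open>v\<^sub>0\<close>, and exchanging the coordinates turns it into \<open>v\<^sub>1\<close>.
\<close>

lemma child_of_std_vertex_orbit:
  "ball_vertex (1 - int n) (poly_to_fls p) \<in> orbit (std_vertex (if n = 0 then 1 else n - 1))"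
proof -
  have "ball_vertex (1 - int n) (poly_to_fls p) \<in> orbit (ball_vertex (1 - int n) 0)"
    using orbit_translate[of _ 0] by simp
  moreover have "ball_vertex (1 - int n) 0 \<in> orbit (std_vertex (if n = 0 then 1 else n - 1))"
    using orbit_swap[of "- 1"] orbit_refl by (auto simp: std_vertex_eq_ball of_nat_diff)
  ultimately show ?thesis by (rule orbit_trans)
qed

lemma adjacent_orbit_std:
  assumes "x \<in> orbit (std_vertex n)" "adjacent x y"
  shows "\<exists>m. y \<in> orbit (std_vertex m)"
proof -
  obtain g :: "'a poly ^ 2 ^ 2" where g: "invertible g" "x = act (map_matrix poly_to_fls g) (std_vertex n)"
    using assms(1) unfolding orbit_def by blast
  then obtain y' where y': "y = act (map_matrix poly_to_fls g) y'" "adjacent (std_vertex n) y'"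
    using assms(2) adjacent_act_iff invertible_map_matrix_poly_to_fls by blast
  have "y \<in> orbit y'"
    unfolding orbit_def using g(1) y'(1) by blast
  moreover have "\<exists>m. y' \<in> orbit (std_vertex m)"
    using y'(2) child_of_std_vertex_orbit orbit_refl unfolding neighbour_of_std_vertex by metis
  ultimately show ?thesis
    using orbit_trans by blast
qed

text \<open>
  A sufficiently large ball around \<open>b\<close> contains \<open>0\<close> and so is one of the \<open>v\<^sub>n\<close>; from there, shrinking the
  radius step by step stays within the orbits.
\<close>

lemma ball_vertex_in_orbit_std: "\<exists>n. ball_vertex m b \<in> orbit (std_vertex n)"
proof -
  define k where "k = min 0 (fls_subdegree b)"
  have base: "\<exists>n. ball_vertex j b \<in> orbit (std_vertex n)" if "j \<le> k" for j
  proof -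
    have "ball_vertex j b = std_vertex (nat (- j))"
      using that by (auto simp: std_vertex_eq_ball ball_vertex_eq_iff k_def ord_ge_def)
    then show ?thesis using orbit_refl by metis
  qed
  show ?thesis
  proof (cases "m \<le> k")
    case False
    then have "k \<le> m" by simp
    then show ?thesis
    proof (induction m rule: int_ge_induct)
      case (step i)
      have "adjacent (ball_vertex i b) (ball_vertex (i + 1) b)"
        unfolding adjacent_ball_iff by (intro disjI2 exI[of _ 0]) simp
      with step.IH show ?case using adjacent_orbit_std by blast
    qed (simp add: base)
  qed (rule base)
qed

text \<open>
  The group of polynomial matrices preserves adjacency and heights, so \<open>x\<close> may be moved to some
  \<open>v\<^sub>n\<close>, where the neighbours are known explicitly.
\<close>

lemma
  fixes x :: "'a::{field,finite} vertex"
  assumes "adjacent x y0"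
  shows height_of_neighbours: "\<exists>z. adjacent x z \<and> height z = Suc (height x) \<and>
      (\<forall>w. adjacent x w \<longrightarrow> w \<noteq> z \<longrightarrow> height w = (if height x = 0 then 1 else height x - 1))"
    and card_of_neighbours: "card {z. adjacent x z} = CARD('a) + 1"
proof -
  obtain n where n: "x \<in> orbit (std_vertex n)"
    using adjacent_imp_ball[OF assms] ball_vertex_in_orbit_std by metis
  then obtain g :: "'a poly ^ 2 ^ 2" where g: "invertible g" "x = act (map_matrix poly_to_fls g) (std_vertex n)"
    unfolding orbit_def by blast
  let ?G = "act (map_matrix poly_to_fls g)"
  have hx: "height x = n" using n by (rule height_eqI)
  have G_orbit: "?G v \<in> orbit v" for v
    unfolding orbit_def using g(1) by blast
  have nbr: "adjacent x y \<longleftrightarrow> y = ?G (std_vertex (Suc n)) \<or>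
      (\<exists>a. y = ?G (ball_vertex (1 - int n) (poly_to_fls (monom a n))))" for y
    unfolding g(2) adjacent_act_iff[OF invertible_map_matrix_poly_to_fls[OF g(1)]] neighbour_of_std_vertex by blast
  have up: "height (?G (std_vertex (Suc n))) = Suc n"
    using G_orbit by (rule height_eqI)
  have down: "height (?G (ball_vertex (1 - int n) (poly_to_fls (monom a n)))) = (if n = 0 then 1 else n - 1)" for a
    using orbit_trans[OF G_orbit child_of_std_vertex_orbit] by (rule height_eqI)
  show "\<exists>z. adjacent x z \<and> height z = Suc (height x) \<and>
      (\<forall>w. adjacent x w \<longrightarrow> w \<noteq> z \<longrightarrow> height w = (if height x = 0 then 1 else height x - 1))"
    using up down unfolding nbr hx by blast
  have inj_G: "v = w" if "?G v = ?G w" for v w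
  proof -
    obtain h where "h ** map_matrix poly_to_fls g = mat 1"
      using invertible_map_matrix_poly_to_fls[OF g(1)] unfolding invertible_def by blast
    then show ?thesis
      using that by (metis act_mat_1 act_mult)
  qed
  \<comment> \<open>The \<open>q\<close> children are distinct: their centres differ in the coefficient of \<open>t\<^sup>n\<close>, which the radius leaves visible.\<close>
  have "inj (\<lambda>a. ?G (ball_vertex (1 - int n) (poly_to_fls (monom a n))))"
  proof (rule injI)
    fix a b assume "?G (ball_vertex (1 - int n) (poly_to_fls (monom a n))) = ?G (ball_vertex (1 - int n) (poly_to_fls (monom b n)))"
    from inj_G[OF this] have "ord_ge (1 - int n) (poly_to_fls (monom a n) - poly_to_fls (monom b n))"
      by (simp only: ball_vertex_eq_iff)
    then have "fls_nth (poly_to_fls (monom a n) - poly_to_fls (monom b n)) (- int n) = 0"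
      by (simp add: ord_ge_iff_nth)
    then show "a = b"
      by (simp add: fls_nth_poly_to_fls)
  qed
  then have "card (range (\<lambda>a. ?G (ball_vertex (1 - int n) (poly_to_fls (monom a n))))) = CARD('a)"
    by (rule card_image)
  moreover have "?G (std_vertex (Suc n)) \<notin> range (\<lambda>a. ?G (ball_vertex (1 - int n) (poly_to_fls (monom a n))))"
  proof
    assume "?G (std_vertex (Suc n)) \<in> range (\<lambda>a. ?G (ball_vertex (1 - int n) (poly_to_fls (monom a n))))"
    then obtain a where "?G (std_vertex (Suc n)) = ?G (ball_vertex (1 - int n) (poly_to_fls (monom a n)))"
      by blast
    from inj_G[OF this] show False
      by (simp add: std_vertex_eq_ball ball_vertex_eq_iff)
  qed
  moreover have "{z. adjacent x z} = insert (?G (std_vertex (Suc n)))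
      (range (\<lambda>a. ?G (ball_vertex (1 - int n) (poly_to_fls (monom a n)))))"
    unfolding nbr by blast
  ultimately show "card {z. adjacent x z} = CARD('a) + 1"
    by simp
qed

section \<open>Counting descendants\<close>

definition ball_level :: "'a::{field,finite} vertex \<Rightarrow> int" where
  "ball_level x = (THE m. \<exists>b. x = ball_vertex m b)"

text \<open>
  The choice of the centre is immaterial: any centre of a ball is a centre of every larger ball
  that contains it.
\<close>

definition ball_parent :: "'a::{field,finite} vertex \<Rightarrow> 'a vertex" where
  "ball_parent x = ball_vertex (ball_level x - 1) (SOME b. x = ball_vertex (ball_level x) b)"

lemma ball_level_ball [simp]: "ball_level (ball_vertex m b) = m"
  unfolding ball_level_def by (rule the_equality) (auto simp: ball_vertex_eq_iff intro: exI[of _ b])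

lemma ball_parent_ball [simp]: "ball_parent (ball_vertex m b) = ball_vertex (m - 1) b"
proof -
  have "ball_vertex m b = ball_vertex m (SOME c. ball_vertex m b = ball_vertex m c)"
    by (rule someI) (rule refl)
  then show ?thesis
    unfolding ball_parent_def ball_level_ball by (auto simp: ball_vertex_eq_iff elim: ord_ge_mono)
      (metis (no_types, lifting) diff_le_eq le_add_same_cancel1 minus_diff_eq ord_ge_mono ord_ge_uminus zero_le_one)
qed

interpretation bruhat_tits: ray_quotient_tree adjacent height "CARD('a)"
  ball_parent "ball_level :: 'a::{field,finite} vertex \<Rightarrow> int"
proof
  fix x y :: "'a vertex" assume adj: "adjacent x y"
  show "adjacent y x" using adj by (rule adjacent_sym)
  show "card {z. adjacent x z} = CARD('a) + 1" using adj by (rule card_of_neighbours)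
  show "\<exists>z. adjacent x z \<and> height z = Suc (height x) \<and>
      (\<forall>w. adjacent x w \<longrightarrow> w \<noteq> z \<longrightarrow> height w = (if height x = 0 then 1 else height x - 1))"
    using adj by (rule height_of_neighbours)
  obtain m b where x: "x = ball_vertex m b"
    using adjacent_imp_ball[OF adj] by blast
  show "ball_level (ball_parent x) = ball_level x - 1"
    by (simp add: x)
  consider "y = ball_vertex (m - 1) b" | a where "y = ball_vertex (m + 1) (b + fls_const a * pi_pow m)"
    using adj unfolding x adjacent_ball_iff by blast
  then show "y = ball_parent x \<or> x = ball_parent y"
  proof cases
    case 2
    have "ord_ge (0 + m) (fls_const a * pi_pow m)"
      by (intro ord_ge_mult) auto
    then show ?thesis
      by (simp add: x 2 ball_vertex_eq_iff)
  qed (simp add: x)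
qed

lemma Desc_eq_paths: "Desc N e = last ` bruhat_tits.paths (fst e) (snd e) N"
proof -
  have "nonbacktracking_path zs \<longleftrightarrow> bruhat_tits.walk ((!) zs) (N + 1)" if "length zs = N + 2" for zs :: "'a vertex list"
    using that by (auto simp: nonbacktracking_path_def bruhat_tits.walk_def)
  then show ?thesis
    unfolding Desc_def bruhat_tits.paths_def by blast
qed

theorem proposition3p7:
  fixes e :: "'a::{field,finite} vertex \<times> 'a vertex" and N j :: nat
  assumes "fwd_state e 1"
  shows "desc_count e N j =
    (if j = N + 1 then 1
     else if 1 \<le> j \<and> j + 1 \<le> N \<and> [j = N + 1] (mod 2)
       then (CARD('a) ^ 2 - 1) * CARD('a) ^ (N - j - 1)
     else if j = 0 \<and> odd N then (CARD('a) - 1) * CARD('a) ^ (N - 1)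
     else 0)"
proof -
  define x where "x = fst e"
  define y where "y = snd e"
  let ?q = "CARD('a)"
  have adj: "adjacent x y" "height x = 0" "height y = 1"
    using assms by (auto simp: fwd_state_def x_def y_def)
  have "{v \<in> Desc N e. height v = j} = last ` {zs \<in> bruhat_tits.paths x y N. height (zs ! Suc N) = j}"
  proof -
    \<comment> \<open>A path of \<open>N\<close> steps after the initial edge has \<open>N + 2\<close> vertices, so its end has index \<open>N + 1\<close>.\<close>
    have "last zs = zs ! Suc N" if "zs \<in> bruhat_tits.paths x y N" for zs
    proof -
      have "length zs = Suc (Suc N)"
        using that by (simp add: bruhat_tits.paths_def)
      then show ?thesis by (subst last_conv_nth) auto
    qed
    then show ?thesis
      unfolding Desc_eq_paths x_def y_def by force
  qed
  then have "desc_count e N j = card {zs \<in> bruhat_tits.paths x y N. height (zs ! Suc N) = j}"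
    unfolding desc_count_def
    by (simp only:) (rule card_image, rule inj_on_subset[OF bruhat_tits.inj_on_last_paths], blast)
  also have "{zs \<in> bruhat_tits.paths x y N. height (zs ! Suc N) = j} =
      {zs \<in> bruhat_tits.paths x y N. height (zs ! Suc N) = Suc (height (zs ! N)) \<and> height (zs ! Suc N) = j} \<union>
      {zs \<in> bruhat_tits.paths x y N. height (zs ! N) = Suc (height (zs ! Suc N)) \<and> height (zs ! Suc N) = j}"
    using bruhat_tits.adj_height[OF bruhat_tits.adj_last_edge] by blast
  also have "card \<dots> = bruhat_tits.fwd_count x y N j + bruhat_tits.bwd_count x y N j"
    unfolding bruhat_tits.fwd_count_def bruhat_tits.bwd_count_def
    using bruhat_tits.finite_paths[OF adj(1)] by (intro card_Un_disjoint) auto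
  also have "\<dots> = (if j = N + 1 then 1
     else if 1 \<le> j \<and> j + 1 \<le> N \<and> even (N + 1 + j)
       then (?q ^ 2 - 1) * ?q ^ (N - j - 1)
     else if j = 0 \<and> odd N then (?q - 1) * ?q ^ (N - 1)
     else 0)"
  proof -
    have "(?q - 1) * ?q ^ (N - j) + (?q - 1) * ?q ^ (N - j - 1) = (?q ^ 2 - 1) * ?q ^ (N - j - 1)"
      if "j + 1 \<le> N"
    proof -
      have "?q ^ (N - j) = ?q * ?q ^ (N - j - 1)"
        using that by (metis Suc_diff_1 Suc_eq_plus1 Suc_le_lessD power_Suc zero_less_diff)
      moreover have "?q ^ 2 - 1 = (?q - 1) * (?q + 1)"
        by (cases ?q) (simp_all add: power2_eq_square)
      ultimately show ?thesis
        by (simp add: algebra_simps)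
    qed
    then show ?thesis
      unfolding bruhat_tits.counts_closed_form[OF adj] by (auto simp: odd_pos Suc_leI)
  qed
  also have "even (N + 1 + j) \<longleftrightarrow> [j = N + 1] (mod 2)"
    by (auto simp: cong_def mod_2_eq_odd)
  finally show ?thesis .
qed

end
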